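(* Let $n\ge 1$ be an integer, let $1\le p<\infty$, and let $K\subset\mathbb{R}^n$ be a convex body containing the origin in its interior (not necessarily origin-symmetric). If $f\in W^{1,p}(\mathbb{R}^n)$ is real-valued and has compact support, then $$\lim_{s\to 1^-}(1-s)\int_{\mathbb{R}^n}\int_{\mathbb{R}^n}\frac{\left(f(x)-f(y)\right)_+^p}{\|x-y\|_K^{\,n+sp}}\,dx\,dy=\frac{1}{p}\int_{\mathbb{R}^n}\|\nabla f(x)\|_{Z_p^{+,*}K}^p\,dx .$$
   Context: For $t\in\mathbb{R}$, $(t)_+=\max\{0,t\}$, and $(t)_+^p$ means $((t)_+)^p$. A convex body is a compact convex subset of $\mathbb{R}^n$ with nonempty interior. For a convex body $K\subset\mathbb{R}^n$ containing the origin in its interior, its Minkowski functional is $\|x\|_K=\min\{\lambda\ge 0: x\in\lambda K\}$, $x\in\mathbb{R}^n$ (not a norm in general, since $K$ need not be origin-symmetric). The polar asymmetric $L_p$ moment body $Z_p^{+,*}K$ of $K$ is the unit ball of the Minkowski functional defined by $$\|v\|_{Z_p^{+,*}K}^p=(n+p)\int_K (v\cdot x)_+^p\,dx,\qquad v\in\mathbb{R}^n,$$ where $v\cdot x$ is the standard inner product. $W^{1,p}(\mathbb{R}^n)$ is the usual Sobolev space of functions in $L^p(\mathbb{R}^n)$ whose weak gradient $\nabla f$ is in $L^p$. The parameter $s$ ranges over $0<s<1$. *)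

theory Defs
  imports "HOL-Analysis.Analysis"
begin

definition convex_body :: "'a::euclidean_space set \<Rightarrow> bool" where
  "convex_body K \<longleftrightarrow> compact K \<and> convex K \<and> interior K \<noteq> {}"

(* For a compact convex K with 0 in its interior the infimum is attained. *)
definition minkowski :: "'a::real_vector set \<Rightarrow> 'a \<Rightarrow> real" where
  "minkowski K x = Inf {l. l \<ge> 0 \<and> x \<in> (*\<^sub>R) l ` K}"

definition moment_functional :: "real \<Rightarrow> 'a::euclidean_space set \<Rightarrow> 'a \<Rightarrow> real" where
  "moment_functional p K v =
     ((real DIM('a) + p) * (LINT x:K|lebesgue. max 0 (v \<bullet> x) powr p)) powr (1 / p)"

definition polar_moment_body :: "real \<Rightarrow> 'a::euclidean_space set \<Rightarrow> 'a set" where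
  "polar_moment_body p K = {v. moment_functional p K v \<le> 1}"

lemma moment_functional_scaleR:
  fixes K :: "'a::euclidean_space set"
  assumes "c \<ge> 0" "p > 0"
  shows "moment_functional p K (c *\<^sub>R v) = c * moment_functional p K v"
proof -
  have m: "max 0 (c * t) = c * max 0 t" for t :: real
    using assms(1) by (simp add: max_mult_distrib_left max_def mult_le_0_iff zero_le_mult_iff)
  have "(LINT x:K|lebesgue. max 0 ((c *\<^sub>R v) \<bullet> x) powr p)
      = (LINT x:K|lebesgue. c powr p * max 0 (v \<bullet> x) powr p)"
    using assms by (simp add: m powr_mult)
  also have "\<dots> = c powr p * (LINT x:K|lebesgue. max 0 (v \<bullet> x) powr p)"
    by simp
  finally have e: "(real DIM('a) + p) * (LINT x:K|lebesgue. max 0 ((c *\<^sub>R v) \<bullet> x) powr p)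
      = c powr p * ((real DIM('a) + p) * (LINT x:K|lebesgue. max 0 (v \<bullet> x) powr p))"
    by simp
  have "0 \<le> (LINT x:K|lebesgue. max 0 (v \<bullet> x) powr p)"
    by (simp add: set_lebesgue_integral_def)
  then show ?thesis
    unfolding moment_functional_def e using assms
    by (subst powr_mult) (auto simp: powr_powr)
qed

lemma minkowski_polar_moment_body:
  fixes K :: "'a::euclidean_space set"
  assumes "p > 0"
  shows "minkowski (polar_moment_body p K) v = moment_functional p K v"
proof -
  let ?g = "moment_functional p K"
  let ?S = "{l. l \<ge> 0 \<and> v \<in> (*\<^sub>R) l ` polar_moment_body p K}"
  have g0: "?g u \<ge> 0" for u by (simp add: moment_functional_def)
  have lower: "?g v \<le> l" if "l \<in> ?S" for l
    using that assms g0
    by (auto simp: polar_moment_body_def moment_functional_scaleR intro: mult_left_le)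
  have mem: "l \<in> ?S" if "l > ?g v" for l
  proof -
    have "l > 0" using that g0[of v] by linarith
    moreover have "(1 / l) *\<^sub>R v \<in> polar_moment_body p K"
      using that \<open>l > 0\<close> assms
      by (simp add: polar_moment_body_def moment_functional_scaleR del: scaleR_scaleR)
    ultimately show ?thesis
      by (auto intro!: image_eqI[where x = "(1 / l) *\<^sub>R v"])
  qed
  have "Inf ?S = ?g v"
  proof (rule antisym)
    show "?g v \<le> Inf ?S"
      by (rule cInf_greatest) (use mem[of "?g v + 1"] lower in auto)
    show "Inf ?S \<le> ?g v"
    proof (rule dense_ge)
      fix l assume "?g v < l"
      then show "Inf ?S \<le> l"
        using lower by (intro cInf_lower[OF mem]) (auto intro!: bdd_belowI[where m = "?g v"])
    qed
  qed
  then show ?thesis by (simp add: minkowski_def)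
qed

corollary minkowski_polar_moment_body_powr:
  fixes K :: "'a::euclidean_space set"
  assumes "p > 0"
  shows "minkowski (polar_moment_body p K) v powr p
       = (real DIM('a) + p) * (LINT x:K|lebesgue. max 0 (v \<bullet> x) powr p)"
proof -
  have "0 \<le> (LINT x:K|lebesgue. max 0 (v \<bullet> x) powr p)"
    by (simp add: set_lebesgue_integral_def)
  then show ?thesis
    unfolding minkowski_polar_moment_body[OF assms] moment_functional_def
    using assms by (simp add: powr_powr)
qed

primrec Ck :: "nat \<Rightarrow> ('a::euclidean_space \<Rightarrow> real) \<Rightarrow> bool" where
  "Ck 0 \<phi> \<longleftrightarrow> continuous_on UNIV \<phi>"
| "Ck (Suc k) \<phi> \<longleftrightarrow> \<phi> differentiable_on UNIV \<and>
     (\<forall>i\<in>Basis. Ck k (\<lambda>x. frechet_derivative \<phi> (at x) i))"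

definition test_function :: "('a::euclidean_space \<Rightarrow> real) \<Rightarrow> bool" where
  "test_function \<phi> \<longleftrightarrow> (\<forall>k. Ck k \<phi>) \<and> compact (closure {x. \<phi> x \<noteq> 0})"

definition locally_integrable ::
    "('a::euclidean_space \<Rightarrow> 'b::{banach, second_countable_topology}) \<Rightarrow> bool" where
  "locally_integrable f \<longleftrightarrow> (\<forall>C. compact C \<longrightarrow> set_integrable lebesgue C f)"

(* The weak gradient is unique only up to null sets, hence a relation. *)
definition has_weak_gradient :: "('a::euclidean_space \<Rightarrow> real) \<Rightarrow> ('a \<Rightarrow> 'a) \<Rightarrow> bool" where
  "has_weak_gradient f g \<longleftrightarrow> locally_integrable f \<and> locally_integrable g \<and>
     (\<forall>\<phi>. test_function \<phi> \<longrightarrow> (\<forall>i\<in>Basis.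
        (LINT x|lebesgue. f x * frechet_derivative \<phi> (at x) i)
          = - (LINT x|lebesgue. (g x \<bullet> i) * \<phi> x)))"

definition Lp :: "real \<Rightarrow> ('a::euclidean_space \<Rightarrow> 'b::euclidean_space) set" where
  "Lp p = {f \<in> borel_measurable lebesgue. integrable lebesgue (\<lambda>x. norm (f x) powr p)}"

definition sobolev_W1 :: "real \<Rightarrow> ('a::euclidean_space \<Rightarrow> real) set" where
  "sobolev_W1 p = {f \<in> Lp p. \<exists>g \<in> Lp p. has_weak_gradient f g}"

(* Compactness of the essential support: invariant under changes on null sets. *)
definition compactly_supported :: "('a::euclidean_space \<Rightarrow> real) \<Rightarrow> bool" where
  "compactly_supported f \<longleftrightarrow> (\<exists>C. compact C \<and> (AE x in lebesgue. x \<notin> C \<longrightarrow> f x = 0))"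

end

theory Submission
  imports Defs
begin

text \<open>
  Write \<open>t\<^sub>+\<close> for \<open>max 0 t\<close>, \<open>n\<close> for the dimension and \<open>\<parallel>z\<parallel>\<close> for the gauge of \<open>K\<close>. The substitution
  \<open>x = y + z\<close> and Tonelli's theorem turn the double integral into \<open>\<integral> F(z) \<parallel>z\<parallel> powr (- n - s p) dz\<close>,
  where \<open>F(z) = \<integral> (f(y + z) - f(y))\<^sub>+ powr p dy\<close> (\<open>diff_energy\<close>). By the definition of the moment
  body, the claimed limit is \<open>((n + p) / p) \<integral>\<^sub>K G\<close> with \<open>G(z) = \<integral> (\<nabla>f(y) \<bullet> z)\<^sub>+ powr p dy\<close> (\<open>grad_energy\<close>).

  Two facts link \<open>F\<close> and \<open>G\<close>: \<open>F \<le> G\<close> everywhere (\<open>diff_energy_le_grad_energy\<close>), and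
  \<open>G(z) \<le> liminf t powr (- p) * F(t z)\<close> as \<open>t\<close> decreases to 0 (\<open>grad_energy_le_liminf_diff_energy\<close>).
  If \<open>f\<close> is continuously differentiable, the first is Jensen's inequality for the mean of \<open>\<nabla>f \<bullet> z\<close>
  along a segment, and the second is Fatou's lemma for difference quotients. The general case follows
  from one principle: for locally integrable \<open>u\<close>, the integral of \<open>u\<^sub>+ powr p\<close> is the supremum over
  \<open>e > 0\<close> of the same integral for the mollifications of \<open>u\<close>. Here \<open>\<ge>\<close> is Jensen's inequality
  (\<open>nn_integral_pos_powr_mollify_le\<close>), and \<open>\<le>\<close> is Fatou's lemma along a sequence of mollifications that
  converges almost everywhere (\<open>nn_integral_pos_powr_le_if_mollify\<close>). Mollification commutes with
  increments and with the weak gradient, so both inequalities pass from the mollifications of \<open>f\<close> to \<open>f\<close>.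

  Polar coordinates are replaced by a layer cake formula: \<open>\<parallel>z\<parallel> powr (- a)\<close> is the integral of
  \<open>a * l powr (- a - 1)\<close> over all \<open>l > 0\<close> with \<open>z \<in> l K\<close>. Tonelli's theorem and the scaling \<open>z = l w\<close> give
  \<open>(1 - s) (n + s p) \<integral> l powr (p (1 - s) - 1) * N(l) dl\<close> over \<open>l > 0\<close>, where
  \<open>N(l) = \<integral>\<^sub>K l powr (- p) * F(l w) dw\<close> (\<open>scaled_energy\<close>). As \<open>s\<close> tends to 1, the probability densities
  \<open>p (1 - s) l powr (p (1 - s) - 1)\<close> on \<open>(0, 1)\<close> concentrate at 0, while the part \<open>l > 1\<close> vanishes in the
  limit because \<open>F\<close> is bounded by a multiple of the \<open>p\<close>-th power of the \<open>L\<^sup>p\<close> norm of \<open>f\<close>. So the limit is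
  \<open>((n + p) / p)\<close> times the limit of \<open>N\<close> at 0 (\<open>radial_limit\<close>), and the two facts above together with
  Fatou's lemma show that \<open>N\<close> tends to \<open>\<integral>\<^sub>K G\<close>. Everything takes place in \<open>[0, \<infinity>]\<close>, where Tonelli's
  theorem and Fatou's lemma need no integrability.
\<close>

section \<open>Smooth bump functions and mollifiers\<close>

text \<open>The functions \<open>exp (- 1 / t) / t ^ k\<close>, extended by 0 to \<open>t \<le> 0\<close>. Keeping the power \<open>k\<close> as a
  parameter makes the family closed under differentiation up to linear combinations, so no induction
  over higher derivatives of a single bump function is needed.\<close>

definition exp_bump :: "nat \<Rightarrow> real \<Rightarrow> real" where
  "exp_bump k t = (if t > 0 then inverse t ^ k * exp (- inverse t) else 0)"

lemma exp_bump_nonneg: "exp_bump k t \<ge> 0"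
  by (simp add: exp_bump_def)

text \<open>Quadratic flatness at 0 is all that differentiability at the gluing point requires; it comes from the
  term of order \<open>k + 2\<close> in the exponential series.\<close>

lemma exp_bump_le_square:
  "exp_bump k t \<le> fact (k + 2) * t\<^sup>2"
proof (cases "t > 0")
  case True
  define r where "r = inverse t"
  have r: "r > 0" and t: "t = inverse r" using True by (simp_all add: r_def)
  have "(\<Sum>n\<in>{k+2}. r ^ n /\<^sub>R fact n) \<le> exp r"
    unfolding exp_def using r summable_exp_generic[of r] by (intro sum_le_suminf) auto
  then have "r ^ (k + 2) / fact (k + 2) \<le> exp r"
    by (simp add: divide_inverse mult.commute del: fact_Suc)
  then have "r ^ (k + 2) \<le> fact (k + 2) * exp r"
    by (simp add: divide_le_eq mult.commute del: fact_Suc)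
  then have "r ^ k * exp (- r) \<le> fact (k + 2) * (inverse r)\<^sup>2"
    using r by (simp add: exp_minus field_simps power_add power2_eq_square del: fact_Suc)
  then show ?thesis using True r by (simp add: exp_bump_def t del: fact_Suc)
qed (simp add: exp_bump_def)

lemma has_derivative_exp_bump:
  "(exp_bump k has_real_derivative exp_bump (k + 2) t - real k * exp_bump (k + 1) t) (at t)"
proof -
  consider "t > 0" | "t < 0" | "t = 0" by linarith
  then show ?thesis
  proof cases
    case 1
    have "((\<lambda>t. inverse t ^ k * exp (- inverse t)) has_real_derivative
        exp_bump (k + 2) t - real k * exp_bump (k + 1) t) (at t)"
      using 1
      by (auto intro!: derivative_eq_intros simp: exp_bump_def power_add algebra_simps power2_eq_square)
         (cases k; simp add: algebra_simps)+
    moreover have "\<forall>\<^sub>F u in nhds t. inverse u ^ k * exp (- inverse u) = exp_bump k u"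
      using eventually_nhds_in_open[of "{0<..}" t] 1
      by (auto elim!: eventually_mono simp: exp_bump_def)
    ultimately show ?thesis
      by (subst (asm) DERIV_cong_ev) auto
  next
    case 2
    have "((\<lambda>t. 0) has_real_derivative exp_bump (k + 2) t - real k * exp_bump (k + 1) t) (at t)"
      using 2 by (simp add: exp_bump_def)
    moreover have "\<forall>\<^sub>F u in nhds t. 0 = exp_bump k u"
      using eventually_nhds_in_open[of "{..<0}" t] 2
      by (auto elim!: eventually_mono simp: exp_bump_def)
    ultimately show ?thesis
      by (subst (asm) DERIV_cong_ev) auto
  next
    case 3
    have "((\<lambda>h. exp_bump k h / h) \<longlongrightarrow> 0) (at 0)"
    proof (rule Lim_null_comparison)
      show "\<forall>\<^sub>F h in at 0. norm (exp_bump k h / h) \<le> fact (k + 2) * \<bar>h\<bar>"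
      proof (rule eventually_at_filter[THEN iffD2], intro always_eventually allI impI)
        fix h :: real assume "h \<noteq> 0"
        then show "norm (exp_bump k h / h) \<le> fact (k + 2) * \<bar>h\<bar>"
          using exp_bump_le_square[of k h] exp_bump_nonneg[of k h]
          by (simp add: divide_le_eq power2_eq_square mult.assoc)
      qed
      show "((\<lambda>h. fact (k + 2) * \<bar>h\<bar>) \<longlongrightarrow> 0) (at (0::real))"
        by (auto intro!: tendsto_eq_intros)
    qed
    then show ?thesis
      using 3 by (simp add: DERIV_def exp_bump_def)
  qed
qed

text \<open>A syntactic class that contains the mollifiers and is closed under partial derivatives. Membership is
  therefore preserved by any number of differentiations, which yields \<open>Ck\<close> for every \<open>k\<close> at once.\<close>

inductive smooth_expr :: "('a::euclidean_space \<Rightarrow> real) \<Rightarrow> bool" where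
  const: "smooth_expr (\<lambda>x. c)"
| coord: "smooth_expr (\<lambda>x. x \<bullet> v)"
| add: "smooth_expr f \<Longrightarrow> smooth_expr g \<Longrightarrow> smooth_expr (\<lambda>x. f x + g x)"
| mult: "smooth_expr f \<Longrightarrow> smooth_expr g \<Longrightarrow> smooth_expr (\<lambda>x. f x * g x)"
| bump: "smooth_expr f \<Longrightarrow> smooth_expr (\<lambda>x. exp_bump k (f x))"

lemma smooth_expr_has_derivative:
  assumes "smooth_expr f"
  shows "\<exists>D. (\<forall>x. (f has_derivative D x) (at x)) \<and> (\<forall>v. smooth_expr (\<lambda>x. D x v))"
  using assms
proof induction
  case (const c)
  show ?case by (rule exI[of _ "\<lambda>_ _. 0"]) (auto intro: smooth_expr.const)
next
  case (coord v)
  show ?case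
    by (rule exI[of _ "\<lambda>_ h. h \<bullet> v"]) (auto intro!: smooth_expr.const derivative_eq_intros)
next
  case (add f g)
  then obtain D E where "\<forall>x. (f has_derivative D x) (at x)" "\<forall>v. smooth_expr (\<lambda>x. D x v)"
    "\<forall>x. (g has_derivative E x) (at x)" "\<forall>v. smooth_expr (\<lambda>x. E x v)" by blast
  then show ?case
    by (intro exI[of _ "\<lambda>x h. D x h + E x h"]) (auto intro!: smooth_expr.add has_derivative_add)
next
  case (mult f g)
  then obtain D E where "\<forall>x. (f has_derivative D x) (at x)" "\<forall>v. smooth_expr (\<lambda>x. D x v)"
    "\<forall>x. (g has_derivative E x) (at x)" "\<forall>v. smooth_expr (\<lambda>x. E x v)" by blast
  then show ?case using mult.hyps
    by (intro exI[of _ "\<lambda>x h. f x * E x h + D x h * g x"])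
       (auto intro!: smooth_expr.add smooth_expr.mult has_derivative_mult)
next
  case (bump f k)
  then obtain D where D: "\<forall>x. (f has_derivative D x) (at x)" "\<forall>v. smooth_expr (\<lambda>x. D x v)"
    by blast
  \<comment> \<open>the derivative of \<open>exp_bump k\<close> at \<open>f x\<close>; it stays in the class\<close>
  let ?h = "\<lambda>x. exp_bump (k + 2) (f x) + (- real k) * exp_bump (k + 1) (f x)"
  have "((\<lambda>x. exp_bump k (f x)) has_derivative (\<lambda>h. ?h x * D x h)) (at x)" for x
    using has_derivative_compose[OF D(1)[rule_format]
        has_derivative_exp_bump[unfolded has_field_derivative_def]]
    by (simp add: mult.commute)
  moreover have "smooth_expr (\<lambda>x. ?h x * D x v)" for v
    by (intro smooth_expr.mult smooth_expr.add smooth_expr.const smooth_expr.bump bump.hyps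
        D(2)[rule_format])
  ultimately show ?case by (intro exI[of _ "\<lambda>x h. ?h x * D x h"]) auto
qed

lemma smooth_expr_frechet_derivative:
  assumes "smooth_expr f"
  shows "(f has_derivative frechet_derivative f (at x)) (at x)"
    and "smooth_expr (\<lambda>x. frechet_derivative f (at x) v)"
proof -
  obtain D where D: "\<forall>x. (f has_derivative D x) (at x)" "\<forall>v. smooth_expr (\<lambda>x. D x v)"
    using smooth_expr_has_derivative[OF assms] by blast
  have "D x = frechet_derivative f (at x)" for x
    using D(1) by (intro frechet_derivative_at) blast
  then show "(f has_derivative frechet_derivative f (at x)) (at x)"
    and "smooth_expr (\<lambda>x. frechet_derivative f (at x) v)"
    using D by (simp_all flip: \<open>\<And>x. D x = _\<close>)
qed

lemma continuous_on_smooth_expr: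
  assumes "smooth_expr f"
  shows "continuous_on A f"
  by (meson assms continuous_at_imp_continuous_on has_derivative_continuous
      smooth_expr_frechet_derivative(1))

lemma Ck_smooth_expr:
  "smooth_expr f \<Longrightarrow> Ck k f"
proof (induction k arbitrary: f)
  case 0
  then show ?case by (simp add: continuous_on_smooth_expr)
next
  case (Suc k)
  have "f differentiable_on UNIV"
    using smooth_expr_frechet_derivative(1)[OF Suc.prems]
    by (meson differentiable_at_imp_differentiable_on differentiable_def)
  then show ?case
    using Suc.IH smooth_expr_frechet_derivative(2)[OF Suc.prems] by simp
qed

lemma test_function_smooth_expr:
  assumes "smooth_expr f" and "\<And>x. f x \<noteq> 0 \<Longrightarrow> x \<in> cball a r"
  shows "test_function f"
  unfolding test_function_def
proof (intro conjI allI)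
  show "Ck k f" for k using assms(1) by (rule Ck_smooth_expr)
  have "bounded {x. f x \<noteq> 0}"
    by (rule bounded_subset[OF bounded_cball[of a r]]) (use assms(2) in blast)
  then show "compact (closure {x. f x \<noteq> 0})" by simp
qed

definition raw_mollifier :: "real \<Rightarrow> 'a::euclidean_space \<Rightarrow> real" where
  "raw_mollifier e z = exp_bump 0 (e\<^sup>2 - z \<bullet> z)"

text \<open>A bump supported in the ball of radius \<open>e\<close>, normalised to integral 1. Normalising for each \<open>e\<close>
  separately, instead of rescaling one bump, avoids any change of variables.\<close>

definition mollifier :: "real \<Rightarrow> 'a::euclidean_space \<Rightarrow> real" where
  "mollifier e z = raw_mollifier e z / (LINT w|lborel. raw_mollifier e (w::'a))"

text \<open>The affine argument \<open>c y + a\<close> covers both the mollifier itself and its reflection \<open>y \<mapsto> x - y\<close>, which is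
  the test function against which weak gradients are paired.\<close>

lemma smooth_expr_raw_mollifier:
  "smooth_expr (\<lambda>y::'a::euclidean_space. raw_mollifier e (c *\<^sub>R y + a))"
proof -
  have "smooth_expr (\<lambda>y. exp_bump 0 ((e\<^sup>2 + (- a) \<bullet> a) + ((y \<bullet> (- 2 * c) *\<^sub>R a)
      + (- (c\<^sup>2)) * (\<Sum>b\<in>Basis. (y \<bullet> b) * (y \<bullet> b)))))"
  proof (intro smooth_expr.bump smooth_expr.add smooth_expr.mult smooth_expr.const smooth_expr.coord)
    have "finite B \<Longrightarrow> smooth_expr (\<lambda>y::'a. \<Sum>b\<in>B. (y \<bullet> b) * (y \<bullet> b))" for B
      by (induction rule: finite_induct)
         (simp_all add: smooth_expr.intros)
    then show "smooth_expr (\<lambda>y::'a. \<Sum>b\<in>Basis. (y \<bullet> b) * (y \<bullet> b))" by simp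
  qed
  moreover have "(e\<^sup>2 + (- a) \<bullet> a) + ((y \<bullet> (- 2 * c) *\<^sub>R a)
      + (- (c\<^sup>2)) * (\<Sum>b\<in>Basis. (y \<bullet> b) * (y \<bullet> b))) = e\<^sup>2 - (c *\<^sub>R y + a) \<bullet> (c *\<^sub>R y + a)" for y
    using euclidean_inner[of y y] by (simp add: inner_commute algebra_simps power2_eq_square)
  ultimately show ?thesis
    by (simp only: raw_mollifier_def)
qed

lemma smooth_expr_mollifier:
  "smooth_expr (\<lambda>y::'a::euclidean_space. mollifier e (c *\<^sub>R y + a))"
  using smooth_expr.mult[OF smooth_expr.const smooth_expr_raw_mollifier]
  by (simp add: mollifier_def divide_inverse mult.commute)

lemma continuous_on_mollifier: "continuous_on A (mollifier e)"
  using continuous_on_smooth_expr[OF smooth_expr_mollifier[where c=1 and a=0]] by simp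

lemma borel_measurable_mollifier [measurable]: "mollifier e \<in> borel_measurable borel"
  by (intro borel_measurable_continuous_onI continuous_on_mollifier)

lemma mollifier_minus: "mollifier e (- z) = mollifier e z"
  by (simp add: mollifier_def raw_mollifier_def)

lemma mollifier_eq_0:
  assumes "e > 0" "norm z \<ge> e" shows "mollifier e z = 0"
proof -
  have "e\<^sup>2 \<le> z \<bullet> z" using assms by (simp add: dot_square_norm)
  then show ?thesis by (simp add: mollifier_def raw_mollifier_def exp_bump_def)
qed

lemma continuous_compact_support_integrable:
  fixes f :: "'a::euclidean_space \<Rightarrow> real"
  assumes "continuous_on UNIV f" "\<And>x. norm x \<ge> e \<Longrightarrow> f x = 0"
  shows "integrable lborel f"
proof -
  have "integrable lborel (\<lambda>x. indicator (cball 0 e) x *\<^sub>R f x)"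
    by (rule borel_integrable_compact) (auto intro: continuous_on_subset[OF assms(1)])
  also have "(\<lambda>x. indicator (cball 0 e) x *\<^sub>R f x) = f"
    using assms(2) by (auto simp: indicator_def fun_eq_iff not_le)
  finally show ?thesis .
qed

lemma integrable_mollifier:
  assumes "e > 0" shows "integrable lborel (mollifier e)"
  by (rule continuous_compact_support_integrable[OF continuous_on_mollifier mollifier_eq_0[OF assms]])

lemma mollifier_nonneg: "mollifier e z \<ge> 0"
  unfolding mollifier_def raw_mollifier_def
  by (intro divide_nonneg_nonneg Bochner_Integration.integral_nonneg exp_bump_nonneg)

lemma integral_mollifier:
  assumes "e > 0" shows "(LINT z|lborel. mollifier e (z::'a::euclidean_space)) = 1"
proof -
  let ?r = "raw_mollifier e :: 'a \<Rightarrow> real"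
  have cont: "continuous_on UNIV ?r"
    using continuous_on_smooth_expr[OF smooth_expr_raw_mollifier[where c=1 and a=0]] by simp
  have int: "integrable lborel ?r"
  proof (rule continuous_compact_support_integrable[OF cont])
    fix x :: 'a assume "e \<le> norm x"
    then have "e\<^sup>2 \<le> x \<bullet> x" using assms by (simp add: dot_square_norm)
    then show "?r x = 0" by (simp add: raw_mollifier_def exp_bump_def)
  qed
  have pos: "?r x \<ge> 0" for x by (simp add: raw_mollifier_def exp_bump_nonneg)
  have "integral\<^sup>L lborel ?r \<noteq> 0"
  proof
    assume "integral\<^sup>L lborel ?r = 0"
    then have "AE x in lborel. ?r x = 0"
      using integral_nonneg_eq_0_iff_AE[OF int] pos by simp
    moreover have "?r x \<noteq> 0" if "x \<in> ball 0 e" for x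
    proof -
      have "x \<bullet> x < e\<^sup>2" using that
        by (simp add: dot_square_norm power_strict_mono)
      then show ?thesis by (simp add: raw_mollifier_def exp_bump_def)
    qed
    ultimately have "AE x in lborel. x \<notin> (ball 0 e :: 'a set)"
      by (auto elim!: eventually_mono)
    then have "ball (0::'a) e \<in> null_sets lborel"
      by (subst (asm) AE_iff_null_sets[symmetric]) auto
    then have "negligible (ball (0::'a) e)"
      using negligible_iff_null_sets null_sets_completionI by blast
    then show False using open_not_negligible[of "ball (0::'a) e"] assms by simp
  qed
  then show ?thesis by (simp add: mollifier_def[abs_def])
qed

lemma test_function_mollifier:
  fixes x :: "'a::euclidean_space"
  assumes "e > 0" shows "test_function (\<lambda>y. mollifier e (x - y))"
proof (rule test_function_smooth_expr[where a = x and r = e])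
  show "smooth_expr (\<lambda>y. mollifier e (x - y))"
    using smooth_expr_mollifier[where c = "-1" and a = x] by simp
  show "y \<in> cball x e" if "mollifier e (x - y) \<noteq> 0" for y
    using mollifier_eq_0[OF assms, of "x - y"] that by (force simp: dist_norm)
qed

section \<open>Convolution with a mollifier and Jensen's inequality\<close>

text \<open>The tangent line of the convex function \<open>t\<^sub>+ powr p\<close> at \<open>m > 0\<close> lies below its graph. For \<open>t \<le> 0\<close> this
  reduces to \<open>p t \<le> (p - 1) m\<close>.\<close>

lemma pos_powr_tangent:
  fixes m t p :: real
  assumes "m > 0" "p \<ge> 1"
  shows "m powr p + p * m powr (p - 1) * (t - m) \<le> max 0 t powr p"
proof (cases "t > 0")
  case True
  have "((\<lambda>x. x powr p) has_real_derivative p * m powr (p - 1)) (at m within {0<..})"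
    using assms by (auto intro!: derivative_eq_intros)
  moreover have "m \<in> interior {0<..}" using assms by (simp add: interior_open)
  ultimately have "max 0 t powr p - m powr p \<ge> p * m powr (p - 1) * (t - m)"
    using convex_on_imp_above_tangent[OF powr_convex[OF assms(2)], of m t "p * m powr (p - 1)"] True
    by (simp add: max_def)
  then show ?thesis by simp
next
  case False
  have "m powr p = m powr (p - 1) * m"
    using assms by (simp add: powr_mult_base mult.commute)
  then have "m powr p + p * m powr (p - 1) * (t - m) = m powr (p - 1) * (p * t - (p - 1) * m)"
    by (simp add: algebra_simps)
  also have "\<dots> \<le> 0"
  proof (rule mult_nonneg_nonpos)
    have "p * t \<le> 0" "(p - 1) * m \<ge> 0" using False assms by (simp_all add: mult_nonneg_nonpos)
    then show "p * t - (p - 1) * m \<le> 0" by linarith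
  qed simp
  also have "0 \<le> max 0 t powr p" by simp
  finally show ?thesis .
qed

text \<open>Integrate the tangent line inequality at the weighted mean \<open>m\<close>. The weight \<open>w\<close> will be a mollifier or the
  indicator of \<open>[0, 1]\<close>. The right-hand side is an extended integral, so it may be infinite.\<close>

lemma jensen_pos_powr:
  fixes w X :: "'b \<Rightarrow> real"
  assumes p: "p \<ge> 1"
    and w: "\<And>y. w y \<ge> 0" "integrable M w" "(LINT y|M. w y) = 1"
    and X: "integrable M (\<lambda>y. w y * X y)"
  shows "ennreal (max 0 (LINT y|M. w y * X y) powr p)
    \<le> (\<integral>\<^sup>+y. ennreal (w y * max 0 (X y) powr p) \<partial>M)"
proof (cases "(LINT y|M. w y * X y) > 0")
  case True
  define m where "m = (LINT y|M. w y * X y)"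
  have m: "m > 0" using True by (simp add: m_def)
  define h where "h y = (m powr p - p * m powr (p - 1) * m) * w y + p * m powr (p - 1) * (w y * X y)" for y
  \<comment> \<open>\<open>h\<close> is the tangent line at \<open>m\<close>, evaluated at \<open>X\<close> and weighted by \<open>w\<close>; its integral is \<open>m powr p\<close>\<close>
  have h: "integrable M h" unfolding h_def using w X by (intro Bochner_Integration.integrable_add) auto
  have "integral\<^sup>L M h = m powr p"
    unfolding h_def using w X by (simp add: m_def[symmetric])
  then have "ennreal (m powr p) \<le> ennreal (LINT y|M. max 0 (h y))"
    using h integral_mono[OF h, of "\<lambda>y. max 0 (h y)"] by (auto intro!: ennreal_leI)
  also have "\<dots> = (\<integral>\<^sup>+y. ennreal (max 0 (h y)) \<partial>M)"
    using h by (intro nn_integral_eq_integral[symmetric]) auto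
  also have "\<dots> \<le> (\<integral>\<^sup>+y. ennreal (w y * max 0 (X y) powr p) \<partial>M)"
  proof (intro nn_integral_mono ennreal_leI)
    fix y
    have "h y = w y * (m powr p + p * m powr (p - 1) * (X y - m))"
      by (simp add: h_def algebra_simps)
    also have "\<dots> \<le> w y * max 0 (X y) powr p"
      using w(1) pos_powr_tangent[OF m p] by (intro mult_left_mono)
    finally show "max 0 (h y) \<le> w y * max 0 (X y) powr p" using w(1) by simp
  qed
  finally show ?thesis using m by (simp add: m_def)
next
  case False
  then show ?thesis by (simp add: max_def)
qed

lemma integrable_indicator_locally_integrable:
  fixes u :: "'a::euclidean_space \<Rightarrow> real"
  assumes [measurable]: "u \<in> borel_measurable borel" and "locally_integrable u" "compact C"
  shows "integrable lborel (\<lambda>x. indicator C x * u x)"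
proof -
  have [measurable]: "C \<in> sets borel" using assms(3) by (simp add: borel_compact)
  have "integrable lebesgue (\<lambda>x. indicator C x * u x)"
    using assms(2,3) by (simp add: locally_integrable_def set_integrable_def)
  then show ?thesis by (subst (asm) integrable_completion) auto
qed

lemma integrable_locally_integrable:
  fixes u :: "'a::euclidean_space \<Rightarrow> real"
  assumes "integrable lborel u"
  shows "locally_integrable u"
  unfolding locally_integrable_def set_integrable_def
proof (intro allI impI)
  fix C :: "'a set" assume "compact C"
  then have [measurable]: "C \<in> sets borel" by (simp add: borel_compact)
  have "integrable lborel (\<lambda>x. indicator C x *\<^sub>R u x)"
    using assms by (intro integrable_mult_indicator) auto
  then show "integrable lebesgue (\<lambda>x. indicator C x *\<^sub>R u x)"
    using assms by (subst integrable_completion) auto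
qed

lemma integrable_compact_support_mult:
  fixes u \<psi> :: "'a::euclidean_space \<Rightarrow> real"
  assumes [measurable]: "u \<in> borel_measurable borel" and "locally_integrable u"
    and cont: "continuous_on UNIV \<psi>" and supp: "\<And>y. \<psi> y \<noteq> 0 \<Longrightarrow> y \<in> C" and C: "compact C"
  shows "integrable lborel (\<lambda>y. \<psi> y * u y)"
proof -
  have [measurable]: "\<psi> \<in> borel_measurable borel" "C \<in> sets borel"
    using cont C by (auto intro: borel_measurable_continuous_onI borel_compact)
  have "compact (\<psi> ` C)"
    using C cont by (intro compact_continuous_image) (auto intro: continuous_on_subset)
  then obtain B where B: "\<And>y. y \<in> C \<Longrightarrow> \<bar>\<psi> y\<bar> \<le> B"
    using bounded_iff[of "\<psi> ` C"] compact_imp_bounded by fastforce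
  have "integrable lborel (\<lambda>y. B * (indicator C y * u y))"
    using integrable_indicator_locally_integrable[OF assms(1,2) C] by simp
  then show ?thesis
  proof (rule Bochner_Integration.integrable_bound)
    show "AE y in lborel. norm (\<psi> y * u y) \<le> norm (B * (indicator C y * u y))"
    proof (intro AE_I2)
      fix y
      show "norm (\<psi> y * u y) \<le> norm (B * (indicator C y * u y))"
        using supp[of y] B[of y] by (cases "\<psi> y = 0") (auto simp: abs_mult intro!: mult_right_mono)
    qed
  qed simp
qed

definition mollify :: "real \<Rightarrow> ('a::euclidean_space \<Rightarrow> real) \<Rightarrow> 'a \<Rightarrow> real" where
  "mollify e u x = (LINT y|lborel. mollifier e (x - y) * u y)"

lemma borel_measurable_mollify [measurable]:
  assumes [measurable]: "u \<in> borel_measurable borel"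
  shows "mollify e u \<in> borel_measurable borel"
  unfolding mollify_def[abs_def] by measurable

lemma integrable_mollifier_mult:
  fixes u :: "'a::euclidean_space \<Rightarrow> real"
  assumes "e > 0" "u \<in> borel_measurable borel" "locally_integrable u"
  shows "integrable lborel (\<lambda>y. mollifier e (x - y) * u y)"
proof (rule integrable_compact_support_mult[where C = "cball x e", OF assms(2,3)])
  show "continuous_on UNIV (\<lambda>y. mollifier e (x - y))"
    by (intro continuous_on_compose2[OF continuous_on_mollifier[of UNIV]] continuous_intros) auto
  show "mollifier e (x - y) \<noteq> 0 \<Longrightarrow> y \<in> cball x e" for y
    using mollifier_eq_0[OF assms(1), of "x - y"] by (force simp: dist_norm)
qed auto

lemma nn_integral_translate:
  fixes h :: "'a::euclidean_space \<Rightarrow> ennreal"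
  assumes [measurable]: "h \<in> borel_measurable borel"
  shows "(\<integral>\<^sup>+x. h (a + x) \<partial>lborel) = (\<integral>\<^sup>+x. h x \<partial>lborel)"
  by (subst (2) lborel_distr_plus[symmetric, of a]) (simp add: nn_integral_distr)

lemma nn_integral_reflect:
  fixes h :: "'a::euclidean_space \<Rightarrow> ennreal"
  assumes [measurable]: "h \<in> borel_measurable borel"
  shows "(\<integral>\<^sup>+x. h (a - x) \<partial>lborel) = (\<integral>\<^sup>+x. h x \<partial>lborel)"
  by (subst (2) lborel_affine[of "-1" a]) (simp_all add: nn_integral_density nn_integral_distr)

lemma integral_translate:
  fixes h :: "'a::euclidean_space \<Rightarrow> real"
  assumes [measurable]: "h \<in> borel_measurable borel"
  shows "(LINT x|lborel. h (a + x)) = (LINT x|lborel. h x)"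
  by (subst (2) lborel_distr_plus[symmetric, of a]) (simp add: integral_distr)

lemma integral_reflect:
  fixes h :: "'a::euclidean_space \<Rightarrow> real"
  assumes [measurable]: "h \<in> borel_measurable borel"
  shows "(LINT x|lborel. h (a - x)) = (LINT x|lborel. h x)"
  by (subst (2) lborel_affine[of "-1" a]) (simp_all add: density_1 integral_distr flip: one_ennreal_def)

lemma nn_integral_mollifier:
  assumes "e > 0"
  shows "(\<integral>\<^sup>+y. ennreal (mollifier e (x - y)) \<partial>lborel) = 1"
    and "(\<integral>\<^sup>+y. ennreal (mollifier e (y - x)) \<partial>lborel) = 1"
proof -
  have *: "(\<integral>\<^sup>+y. ennreal (mollifier e (y::'a)) \<partial>lborel) = 1"
    using integral_mollifier[OF assms, where ?'a='a] integrable_mollifier[OF assms]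
    by (subst nn_integral_eq_integral) (auto simp: mollifier_nonneg)
  then show "(\<integral>\<^sup>+y. ennreal (mollifier e (x - y)) \<partial>lborel) = 1"
    by (subst nn_integral_reflect[where h = "\<lambda>y. ennreal (mollifier e y)"]) auto
  then show "(\<integral>\<^sup>+y. ennreal (mollifier e (y - x)) \<partial>lborel) = 1"
    by (subst (asm) mollifier_minus[symmetric]) simp
qed

lemma integral_mollifier_reflect:
  assumes "e > 0"
  shows "integrable lborel (\<lambda>y. mollifier e (x - y))" "(LINT y|lborel. mollifier e (x - y)) = 1"
proof -
  show "integrable lborel (\<lambda>y. mollifier e (x - y))"
    using nn_integral_mollifier(1)[OF assms, of x]
    by (intro integrableI_nonneg) (auto simp: mollifier_nonneg)
  show "(LINT y|lborel. mollifier e (x - y)) = 1"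
    using integral_mollifier[OF assms] by (subst integral_reflect) auto
qed

lemma nn_integral_mollifier_mult:
  fixes h :: "'a::euclidean_space \<Rightarrow> ennreal"
  assumes e: "e > 0" and [measurable]: "h \<in> borel_measurable borel"
  shows "(\<integral>\<^sup>+x. (\<integral>\<^sup>+y. ennreal (mollifier e (x - y)) * h y \<partial>lborel) \<partial>lborel) = (\<integral>\<^sup>+y. h y \<partial>lborel)"
proof -
  have "(\<integral>\<^sup>+x. (\<integral>\<^sup>+y. ennreal (mollifier e (x - y)) * h y \<partial>lborel) \<partial>lborel)
      = (\<integral>\<^sup>+y. (\<integral>\<^sup>+x. ennreal (mollifier e (x - y)) * h y \<partial>lborel) \<partial>lborel)"
    by (intro lborel_pair.Fubini') measurable
  also have "\<dots> = (\<integral>\<^sup>+y. h y \<partial>lborel)"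
    by (intro nn_integral_cong) (simp add: nn_integral_multc nn_integral_mollifier(2)[OF e])
  finally show ?thesis .
qed

text \<open>Jensen's inequality for the probability density \<open>mollifier e (x - y)\<close>, followed by Tonelli's theorem:
  averaging does not increase the integral of a convex function.\<close>

lemma nn_integral_pos_powr_mollify_le:
  fixes u :: "'a::euclidean_space \<Rightarrow> real"
  assumes "p \<ge> 1" "e > 0" and [measurable]: "u \<in> borel_measurable borel" and "locally_integrable u"
  shows "(\<integral>\<^sup>+x. ennreal (max 0 (mollify e u x) powr p) \<partial>lborel)
    \<le> (\<integral>\<^sup>+x. ennreal (max 0 (u x) powr p) \<partial>lborel)"
proof -
  have "(\<integral>\<^sup>+x. ennreal (max 0 (mollify e u x) powr p) \<partial>lborel)
    \<le> (\<integral>\<^sup>+x. (\<integral>\<^sup>+y. ennreal (mollifier e (x - y) * max 0 (u y) powr p) \<partial>lborel) \<partial>lborel)"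
    unfolding mollify_def
    using assms by (intro nn_integral_mono jensen_pos_powr)
      (auto simp: mollifier_nonneg integral_mollifier_reflect integrable_mollifier_mult)
  also have "\<dots> = (\<integral>\<^sup>+x. ennreal (max 0 (u x) powr p) \<partial>lborel)"
    by (simp add: ennreal_mult' mollifier_nonneg nn_integral_mollifier_mult[OF assms(2)])
  finally show ?thesis .
qed

lemma nn_integral_abs_mollify_le:
  fixes v :: "'a::euclidean_space \<Rightarrow> real"
  assumes "e > 0" and [measurable]: "v \<in> borel_measurable borel" and "locally_integrable v"
  shows "(\<integral>\<^sup>+x. ennreal \<bar>mollify e v x\<bar> \<partial>lborel) \<le> (\<integral>\<^sup>+x. ennreal \<bar>v x\<bar> \<partial>lborel)"
proof -
  have "(\<integral>\<^sup>+x. ennreal \<bar>mollify e v x\<bar> \<partial>lborel)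
    \<le> (\<integral>\<^sup>+x. (\<integral>\<^sup>+y. ennreal (mollifier e (x - y) * \<bar>v y\<bar>) \<partial>lborel) \<partial>lborel)"
    unfolding mollify_def
  proof (intro nn_integral_mono)
    fix x
    show "ennreal \<bar>LINT y|lborel. mollifier e (x - y) * v y\<bar>
        \<le> (\<integral>\<^sup>+y. ennreal (mollifier e (x - y) * \<bar>v y\<bar>) \<partial>lborel)"
      using integral_norm_bound_ennreal[OF integrable_mollifier_mult[OF assms, of x]]
      by (simp add: abs_mult mollifier_nonneg)
  qed
  also have "\<dots> = (\<integral>\<^sup>+x. ennreal \<bar>v x\<bar> \<partial>lborel)"
    by (simp add: ennreal_mult' mollifier_nonneg nn_integral_mollifier_mult[OF assms(1)])
  finally show ?thesis .
qed

lemma mollify_diff: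
  fixes u v :: "'a::euclidean_space \<Rightarrow> real"
  assumes "e > 0" "u \<in> borel_measurable borel" "locally_integrable u"
    "v \<in> borel_measurable borel" "locally_integrable v"
  shows "mollify e (\<lambda>y. u y - v y) x = mollify e u x - mollify e v x"
  unfolding mollify_def using assms
  by (simp add: right_diff_distrib integrable_mollifier_mult)

lemma mollify_translate:
  fixes u :: "'a::euclidean_space \<Rightarrow> real"
  assumes [measurable]: "u \<in> borel_measurable borel"
  shows "mollify e (\<lambda>y. u (y + z)) x = mollify e u (x + z)"
  unfolding mollify_def
  using integral_translate[where h = "\<lambda>y. mollifier e (x + z - y) * u y" and a = z]
  by (simp add: add.commute)

section \<open>Convergence of mollifications\<close>

text \<open>Truncate \<open>v\<close> in range and in space, then replace it by continuous functions that converge to it almost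
  everywhere. The same truncation, applied to these, supplies a uniform integrable bound on a ball, so
  both steps are instances of dominated convergence.\<close>

lemma integrable_approx_continuous:
  fixes v :: "'a::euclidean_space \<Rightarrow> real"
  assumes v: "integrable lborel v" and d: "d > 0"
  obtains c R where "continuous_on UNIV c" "\<And>x. norm x \<ge> R \<Longrightarrow> c x = 0"
    "(\<integral>\<^sup>+x. ennreal \<bar>v x - c x\<bar> \<partial>lborel) < ennreal d"
proof -
  have [measurable]: "v \<in> borel_measurable borel" using v by auto
  define clamp :: "real \<Rightarrow> real \<Rightarrow> real" where "clamp R t = max (-R) (min R t)" for R t
  define cut :: "real \<Rightarrow> 'a \<Rightarrow> real" where "cut R x = max 0 (min 1 (R + 1 - norm x))" for R x
  have cut: "0 \<le> cut R x" "cut R x \<le> 1" for R x by (simp_all add: cut_def)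
  have clamp: "\<bar>clamp R t\<bar> \<le> R" if "R \<ge> 0" for R t using that by (auto simp: clamp_def)
  have [measurable]: "cut R \<in> borel_measurable borel" "clamp R \<in> borel_measurable borel" for R
    unfolding cut_def[abs_def] clamp_def[abs_def] by measurable
  \<comment> \<open>truncate \<open>v\<close> in range and in space\<close>
  let ?t = "\<lambda>R x. clamp R (v x) * cut R x"
  have "(\<lambda>n. LINT x|lborel. \<bar>v x - ?t (real n) x\<bar>) \<longlonglongrightarrow> (LINT x::'a|lborel. 0)"
  proof (rule integral_dominated_convergence[where w = "\<lambda>x. \<bar>v x\<bar>"])
    show "AE x in lborel. (\<lambda>n. \<bar>v x - ?t (real n) x\<bar>) \<longlonglongrightarrow> 0"
    proof (intro AE_I2 tendsto_eventually)
      fix x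
      show "\<forall>\<^sub>F n in sequentially. \<bar>v x - ?t (real n) x\<bar> = 0"
        using eventually_ge_at_top[of "nat \<lceil>max \<bar>v x\<bar> (norm x)\<rceil>"]
      proof eventually_elim
        case (elim n)
        then have "max \<bar>v x\<bar> (norm x) \<le> real n" by linarith
        then show ?case by (auto simp: clamp_def cut_def)
      qed
    qed
    fix n
    show "AE x in lborel. norm \<bar>v x - ?t (real n) x\<bar> \<le> \<bar>v x\<bar>"
    proof (intro AE_I2)
      fix x
      define k where "k = cut (real n) x"
      have k: "0 \<le> k" "k \<le> 1" using cut by (simp_all add: k_def)
      have shrink: "0 \<le> a * k \<and> a * k \<le> b" if "0 \<le> a" "a \<le> b" for a b
        using that k mult_left_le[of k a] by auto
      have "\<bar>v x - clamp (real n) (v x) * k\<bar> \<le> \<bar>v x\<bar>"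
      proof (cases "v x \<ge> 0")
        case True
        then have "0 \<le> clamp (real n) (v x)" "clamp (real n) (v x) \<le> v x" by (auto simp: clamp_def)
        with shrink[of "clamp (real n) (v x)" "v x"] show ?thesis by simp
      next
        case False
        then have "0 \<le> - clamp (real n) (v x)" "- clamp (real n) (v x) \<le> - v x" by (auto simp: clamp_def)
        with shrink[of "- clamp (real n) (v x)" "- v x"] show ?thesis by simp
      qed
      then show "norm \<bar>v x - ?t (real n) x\<bar> \<le> \<bar>v x\<bar>" by (simp add: k_def)
    qed
  qed (use v in auto)
  then have "(\<lambda>n. LINT x|lborel. \<bar>v x - ?t (real n) x\<bar>) \<longlonglongrightarrow> 0" by simp
  then have "\<forall>\<^sub>F n in sequentially. (LINT x|lborel. \<bar>v x - ?t (real n) x\<bar>) < d / 2"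
    using d by (intro order_tendstoD(2)) auto
  then obtain n where n: "(LINT x|lborel. \<bar>v x - ?t (real n) x\<bar>) < d / 2"
    by (auto simp: eventually_sequentially)
  define R where "R = real n"
  have R: "R \<ge> 0" by (simp add: R_def)
  \<comment> \<open>the truncated function is an almost everywhere limit of continuous functions with the same truncation\<close>
  have "v \<in> borel_measurable lebesgue" by (simp add: measurable_completion)
  then have "v measurable_on UNIV" by (rule lebesgue_measurable_imp_measurable_on) simp
  then obtain N g where N: "negligible N" and g: "\<And>n. continuous_on UNIV (g n)"
    "\<And>x. x \<notin> N \<Longrightarrow> (\<lambda>n. g n x) \<longlonglongrightarrow> v x"
    by (auto simp: measurable_on_def)
  have [measurable]: "g n \<in> borel_measurable borel" for n
    using g(1) by (intro borel_measurable_continuous_onI)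
  have AE: "AE x in lborel. x \<notin> N"
    using N negligible_iff_null_sets AE_not_in by (metis AE_completion_iff)
  let ?c = "\<lambda>m x. clamp R (g m x) * cut R x"
  have zero: "cut R x = 0" if "norm x \<ge> R + 1" for x using that by (simp add: cut_def)
  have int_ball: "integrable lborel (\<lambda>x::'a. 2 * R * indicator (cball 0 (R + 1)) x)"
    using emeasure_lborel_cball_finite[of "0::'a" "R + 1"]
    by (intro integrable_mult_right integrable_real_indicator) auto
  have bound: "\<bar>clamp R s * cut R x\<bar> \<le> R * indicator (cball 0 (R + 1)) x" for s and x :: 'a
  proof (cases "norm x \<le> R + 1")
    case True
    have "\<bar>clamp R s\<bar> * \<bar>cut R x\<bar> \<le> R * 1"
      using clamp[OF R] cut R by (intro mult_mono) auto
    then show ?thesis using True by (simp add: abs_mult)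
  qed (simp add: zero)
  have int_trunc: "integrable lborel (\<lambda>x. clamp R (h x) * cut R x)"
    if [measurable]: "h \<in> borel_measurable borel" for h :: "'a \<Rightarrow> real"
    by (rule Bochner_Integration.integrable_bound[OF int_ball])
       (use bound R in \<open>auto intro!: AE_I2 order_trans[OF bound] mult_right_mono\<close>)
  have "(\<lambda>m. LINT x|lborel. \<bar>?t R x - ?c m x\<bar>) \<longlonglongrightarrow> (LINT x::'a|lborel. 0)"
  proof (rule integral_dominated_convergence[where w = "\<lambda>x. 2 * R * indicator (cball 0 (R + 1)) x"])
    show "AE x in lborel. (\<lambda>m. \<bar>?t R x - ?c m x\<bar>) \<longlonglongrightarrow> 0"
      using AE
    proof eventually_elim
      case (elim x)
      have "(\<lambda>m. \<bar>?t R x - ?c m x\<bar>) \<longlonglongrightarrow> \<bar>?t R x - ?t R x\<bar>"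
        unfolding clamp_def by (intro tendsto_intros g(2) elim)
      then show ?case by simp
    qed
    fix m
    show "AE x in lborel. norm \<bar>?t R x - ?c m x\<bar> \<le> 2 * R * indicator (cball 0 (R + 1)) x"
    proof (intro AE_I2)
      fix x :: 'a
      show "norm \<bar>?t R x - ?c m x\<bar> \<le> 2 * R * indicator (cball 0 (R + 1)) x"
        using bound[of "v x" x] bound[of "g m x" x] by simp
    qed
  qed (use int_ball in auto)
  then have "(\<lambda>m. LINT x|lborel. \<bar>?t R x - ?c m x\<bar>) \<longlonglongrightarrow> 0" by simp
  then have "\<forall>\<^sub>F m in sequentially. (LINT x|lborel. \<bar>?t R x - ?c m x\<bar>) < d / 2"
    using d by (intro order_tendstoD(2)) auto
  then obtain m where m: "(LINT x|lborel. \<bar>?t R x - ?c m x\<bar>) < d / 2"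
    by (auto simp: eventually_sequentially)
  have i: "integrable lborel (?t R)" "integrable lborel (?c m)" using int_trunc by auto
  have "(LINT x|lborel. \<bar>v x - ?c m x\<bar>) \<le> (LINT x|lborel. \<bar>v x - ?t R x\<bar> + \<bar>?t R x - ?c m x\<bar>)"
    using i v by (intro integral_mono) auto
  also have "\<dots> = (LINT x|lborel. \<bar>v x - ?t R x\<bar>) + (LINT x|lborel. \<bar>?t R x - ?c m x\<bar>)"
    using i v by (intro Bochner_Integration.integral_add) auto
  also have "\<dots> < d" using n m by (simp add: R_def)
  finally have "ennreal (LINT x|lborel. \<bar>v x - ?c m x\<bar>) < ennreal d"
    using d by (intro ennreal_lessI)
  moreover have "(\<integral>\<^sup>+x. ennreal \<bar>v x - ?c m x\<bar> \<partial>lborel) = ennreal (LINT x|lborel. \<bar>v x - ?c m x\<bar>)"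
    using i v by (intro nn_integral_eq_integral) auto
  ultimately have "(\<integral>\<^sup>+x. ennreal \<bar>v x - ?c m x\<bar> \<partial>lborel) < ennreal d" by simp
  moreover have "continuous_on UNIV (?c m)"
    unfolding clamp_def cut_def by (intro continuous_intros g(1))
  ultimately show ?thesis using that[of "?c m" "R + 1"] zero by simp
qed

text \<open>A continuous function with bounded support is uniformly continuous, so its mollification is uniformly
  close to it, and the difference vanishes outside a fixed ball once \<open>e < 1\<close>.\<close>

lemma mollify_continuous_close:
  fixes c :: "'a::euclidean_space \<Rightarrow> real"
  assumes "continuous_on UNIV c" "\<And>x. norm x \<ge> R \<Longrightarrow> c x = 0" "d > 0"
  shows "\<forall>\<^sub>F e in at_right 0. (\<integral>\<^sup>+x. ennreal \<bar>mollify e c x - c x\<bar> \<partial>lborel) < ennreal d"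
proof -
  have [measurable]: "c \<in> borel_measurable borel"
    using assms(1) by (intro borel_measurable_continuous_onI)
  have li: "locally_integrable c"
    by (intro integrable_locally_integrable continuous_compact_support_integrable[where e = R] assms) auto
  define V where "V = measure lborel (cball (0::'a) (R + 1))"
  have V: "V \<ge> 0" "emeasure lborel (cball (0::'a) (R + 1)) = ennreal V"
    using emeasure_lborel_cball_finite[of "0::'a" "R + 1"]
    by (auto simp: V_def emeasure_eq_ennreal_measure)
  define w where "w = d / (2 * (V + 1))"
  have w: "w > 0" using assms(3) V by (simp add: w_def)
  have "uniformly_continuous_on (cball 0 (R + 2)) c"
    by (intro compact_uniformly_continuous continuous_on_subset[OF assms(1)]) auto
  then obtain \<delta> where \<delta>: "\<delta> > 0" "\<And>x y. x \<in> cball 0 (R + 2) \<Longrightarrow> y \<in> cball 0 (R + 2) \<Longrightarrow>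
      dist y x < \<delta> \<Longrightarrow> dist (c y) (c x) < w"
    using w unfolding uniformly_continuous_on_def by metis
  have "\<forall>\<^sub>F e in at_right 0. e < min 1 \<delta> \<and> 0 < (e::real)"
    using \<delta>(1) eventually_at_right_less[of "0::real"]
    by (intro eventually_conj order_tendstoD(2)[of _ 0]) (auto intro: tendsto_eq_intros)
  then show ?thesis
  proof eventually_elim
    case (elim e)
    then have e: "e > 0" "e < 1" "e < \<delta>" by auto
    have "\<bar>mollify e c x - c x\<bar> \<le> w * indicator (cball 0 (R + 1)) x" for x
    proof -
      have int: "integrable lborel (\<lambda>y. mollifier e (x - y) * c y)"
        by (intro integrable_mollifier_mult e li) auto
      have near: "mollifier e (x - y) \<noteq> 0 \<Longrightarrow> norm (x - y) < e" for y
        using mollifier_eq_0[OF e(1), of "x - y"] by force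
      have "mollify e c x - c x = (LINT y|lborel. mollifier e (x - y) * c y - mollifier e (x - y) * c x)"
        using int integral_mollifier_reflect[OF e(1), of x] by (simp add: mollify_def)
      then have "\<bar>mollify e c x - c x\<bar> \<le> (LINT y|lborel. \<bar>mollifier e (x - y) * c y - mollifier e (x - y) * c x\<bar>)"
        by (simp add: integral_abs_bound)
      also have "\<dots> \<le> (LINT y|lborel. mollifier e (x - y) * (w * indicator (cball 0 (R + 1)) x))"
      proof (intro integral_mono)
        fix y
        have "\<bar>c y - c x\<bar> \<le> w * indicator (cball 0 (R + 1)) x" if n: "norm (x - y) < e"
        proof (cases "norm x \<le> R + 1")
          case True
          then have "norm y \<le> R + 2" using norm_triangle_ineq2[of y x] n e
            by (simp add: norm_minus_commute)
          then show ?thesis using \<delta>(2)[of x y] True n e by (simp add: dist_norm norm_minus_commute)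
        next
          case False
          then have "norm y \<ge> R" using norm_triangle_ineq2[of x y] n e by simp
          then show ?thesis using False by (simp add: assms(2))
        qed
        then have "mollifier e (x - y) * \<bar>c y - c x\<bar> \<le> mollifier e (x - y) * (w * indicator (cball 0 (R + 1)) x)"
          using near mollifier_nonneg[of e "x - y"]
          by (cases "mollifier e (x - y) = 0") (auto intro: mult_left_mono)
        then show "\<bar>mollifier e (x - y) * c y - mollifier e (x - y) * c x\<bar>
            \<le> mollifier e (x - y) * (w * indicator (cball 0 (R + 1)) x)"
          by (simp add: mollifier_nonneg abs_mult flip: right_diff_distrib)
      qed (use int integral_mollifier_reflect[OF e(1), of x] in auto)
      also have "\<dots> = w * indicator (cball 0 (R + 1)) x"
        using integral_mollifier_reflect[OF e(1), of x] by simp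
      finally show ?thesis .
    qed
    then have "(\<integral>\<^sup>+x. ennreal \<bar>mollify e c x - c x\<bar> \<partial>lborel)
        \<le> (\<integral>\<^sup>+x. ennreal w * indicator (cball (0::'a) (R + 1)) x \<partial>lborel)"
      using w by (intro nn_integral_mono) (simp add: ennreal_leI flip: ennreal_indicator ennreal_mult)
    also have "\<dots> = ennreal w * ennreal V"
      by (simp add: nn_integral_cmult_indicator V(2))
    also have "\<dots> = ennreal (w * V)" using w V by (simp add: ennreal_mult)
    also have "\<dots> < ennreal d"
    proof (rule ennreal_lessI)
      have "w * V \<le> w * (V + 1)" using w by simp
      also have "\<dots> = d / 2" using V by (simp add: w_def field_simps)
      finally show "w * V < d" using assms(3) by simp
    qed (use assms in auto)
    finally show ?case .
  qed
qed

text \<open>Split off a continuous approximation \<open>c\<close> of \<open>v\<close>: since mollification does not increase the \<open>L\<^sup>1\<close> norm, the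
  error \<open>v - c\<close> enters only twice.\<close>

lemma mollify_tendsto_L1:
  fixes v :: "'a::euclidean_space \<Rightarrow> real"
  assumes v: "integrable lborel v" and d: "d > 0"
  shows "\<forall>\<^sub>F e in at_right 0. (\<integral>\<^sup>+x. ennreal \<bar>mollify e v x - v x\<bar> \<partial>lborel) < ennreal d"
proof -
  obtain c R where c: "continuous_on UNIV c" "\<And>x. norm x \<ge> R \<Longrightarrow> c x = 0"
    "(\<integral>\<^sup>+x. ennreal \<bar>v x - c x\<bar> \<partial>lborel) < ennreal (d / 3)"
    using integrable_approx_continuous[OF v, of "d / 3"] d by auto
  have [measurable]: "v \<in> borel_measurable borel" "c \<in> borel_measurable borel"
    using v c(1) by (auto intro: borel_measurable_continuous_onI)
  have ci: "integrable lborel c"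
    by (rule continuous_compact_support_integrable[OF c(1,2)])
  have "\<forall>\<^sub>F e in at_right 0. (\<integral>\<^sup>+x. ennreal \<bar>mollify e c x - c x\<bar> \<partial>lborel) < ennreal (d / 3)"
    using mollify_continuous_close[OF c(1,2)] d by simp
  then show ?thesis
    using eventually_at_right_less[of "0::real"]
  proof eventually_elim
    case (elim e)
    note * = elim(1) and e = elim(2)
    have "\<bar>mollify e v x - v x\<bar> \<le> \<bar>mollify e (\<lambda>y. v y - c y) x\<bar> + \<bar>mollify e c x - c x\<bar> + \<bar>v x - c x\<bar>" for x
      using mollify_diff[OF e _ integrable_locally_integrable[OF v] _ integrable_locally_integrable[OF ci], of x]
      by simp
    then have "(\<integral>\<^sup>+x. ennreal \<bar>mollify e v x - v x\<bar> \<partial>lborel)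
       \<le> (\<integral>\<^sup>+x. ennreal \<bar>mollify e (\<lambda>y. v y - c y) x\<bar> + ennreal \<bar>mollify e c x - c x\<bar>
            + ennreal \<bar>v x - c x\<bar> \<partial>lborel)"
      by (intro nn_integral_mono) (simp flip: ennreal_plus)
    also have "\<dots> = (\<integral>\<^sup>+x. ennreal \<bar>mollify e (\<lambda>y. v y - c y) x\<bar> \<partial>lborel)
        + (\<integral>\<^sup>+x. ennreal \<bar>mollify e c x - c x\<bar> \<partial>lborel) + (\<integral>\<^sup>+x. ennreal \<bar>v x - c x\<bar> \<partial>lborel)"
      by (simp add: nn_integral_add)
    also have "(\<integral>\<^sup>+x. ennreal \<bar>mollify e (\<lambda>y. v y - c y) x\<bar> \<partial>lborel)
        \<le> (\<integral>\<^sup>+x. ennreal \<bar>v x - c x\<bar> \<partial>lborel)"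
      using v ci by (intro nn_integral_abs_mollify_le e integrable_locally_integrable) auto
    finally have "(\<integral>\<^sup>+x. ennreal \<bar>mollify e v x - v x\<bar> \<partial>lborel)
      \<le> (\<integral>\<^sup>+x. ennreal \<bar>v x - c x\<bar> \<partial>lborel) + (\<integral>\<^sup>+x. ennreal \<bar>mollify e c x - c x\<bar> \<partial>lborel)
        + (\<integral>\<^sup>+x. ennreal \<bar>v x - c x\<bar> \<partial>lborel)"
      by (simp add: add_right_mono)
    also have "\<dots> < ennreal (d / 3) + ennreal (d / 3) + ennreal (d / 3)"
      using * c(3) by (intro add_strict_mono)
    also have "\<dots> = ennreal d" using d by (simp flip: ennreal_plus)
    finally show ?case .
  qed
qed

lemma mollify_AE_subseq:
  fixes v :: "'a::euclidean_space \<Rightarrow> real"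
  assumes v: "integrable lborel v"
  obtains e :: "nat \<Rightarrow> real" where "\<And>n. 0 < e n" "\<And>n. e n \<le> 1"
    "AE x in lborel. (\<lambda>n. mollify (e n) v x) \<longlonglongrightarrow> v x"
proof -
  have [measurable]: "v \<in> borel_measurable borel" using v by auto
  have "\<exists>e. 0 < e \<and> e \<le> 1 \<and> (\<integral>\<^sup>+x. ennreal \<bar>mollify e v x - v x\<bar> \<partial>lborel) < ennreal (inverse (real (Suc n)))" for n
  proof -
    have "\<forall>\<^sub>F e in at_right 0. (e::real) < 1 \<and> 0 < e"
      using eventually_at_right_less[of "0::real"]
      by (intro eventually_conj order_tendstoD(2)[of _ 0]) (auto intro: tendsto_eq_intros)
    from eventually_conj[OF this mollify_tendsto_L1[OF v, of "inverse (real (Suc n))"]]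
    have "\<forall>\<^sub>F e in at_right 0. 0 < e \<and> e \<le> 1 \<and>
        (\<integral>\<^sup>+x. ennreal \<bar>mollify e v x - v x\<bar> \<partial>lborel) < ennreal (inverse (real (Suc n)))"
      by (auto elim: eventually_mono)
    then show ?thesis
      using eventually_happens trivial_limit_at_right_real by blast
  qed
  then obtain e where e: "\<And>n. 0 < e n" "\<And>n. e n \<le> 1"
    "\<And>n. (\<integral>\<^sup>+x. ennreal \<bar>mollify (e n) v x - v x\<bar> \<partial>lborel) < ennreal (inverse (real (Suc n)))"
    by metis
  let ?w = "\<lambda>n x. mollify (e n) v x - v x"
  have int: "integrable lborel (?w n)" for n
    using e(3)[of n] by (intro integrableI_bounded) (auto intro: less_trans)
  have "(\<lambda>n. LINT x|lborel. norm (?w n x)) \<longlonglongrightarrow> 0"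
  proof (rule tendsto_sandwich[OF _ _ tendsto_const LIMSEQ_inverse_real_of_nat])
    have "ennreal (LINT x|lborel. norm (?w n x)) < ennreal (inverse (real (Suc n)))" for n
      using e(3)[of n] int[of n] by (subst nn_integral_eq_integral[symmetric]) auto
    then have "(LINT x|lborel. norm (?w n x)) \<le> inverse (real (Suc n))" for n
      by (metis ennreal_le_iff inverse_nonnegative_iff_nonnegative less_imp_le of_nat_0_le_iff)
    then show "\<forall>\<^sub>F n in sequentially. (LINT x|lborel. norm (?w n x)) \<le> inverse (real (Suc n))"
      by simp
  qed simp
  from tendsto_L1_AE_subseq[OF int this] obtain r where
    "AE x in lborel. (\<lambda>n. ?w (r n) x) \<longlonglongrightarrow> 0" by blast
  then have "AE x in lborel. (\<lambda>n. mollify (e (r n)) v x) \<longlonglongrightarrow> v x"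
    by (auto elim!: eventually_mono simp: LIM_zero_iff)
  then show ?thesis using that[of "\<lambda>n. e (r n)"] e by blast
qed

text \<open>On the ball of radius \<open>k\<close>, the mollifications of \<open>u\<close> with \<open>e \<le> 1\<close> only see \<open>u\<close> on the ball of radius
  \<open>k + 1\<close>, where \<open>u\<close> is integrable. So some sequence of them converges to \<open>u\<close> almost everywhere on the smaller
  ball, and Fatou's lemma gives the bound there; then \<open>k\<close> tends to infinity.\<close>

lemma nn_integral_pos_powr_le_if_mollify:
  fixes u :: "'a::euclidean_space \<Rightarrow> real"
  assumes p: "p > 0" and [measurable]: "u \<in> borel_measurable borel" and li: "locally_integrable u"
    and le: "\<And>e. e > 0 \<Longrightarrow> (\<integral>\<^sup>+x. ennreal (max 0 (mollify e u x) powr p) \<partial>lborel) \<le> C"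
  shows "(\<integral>\<^sup>+x. ennreal (max 0 (u x) powr p) \<partial>lborel) \<le> C"
proof -
  let ?q = "\<lambda>t. ennreal (max 0 t powr p)"
  have [measurable]: "cball (0::'a) (real k) \<in> sets borel" for k by simp
  have ball: "(\<integral>\<^sup>+x. ?q (u x) * indicator (cball 0 (real k)) x \<partial>lborel) \<le> C" for k
  proof -
    define v where "v x = indicator (cball 0 (real k + 1)) x * u x" for x
    have v: "integrable lborel v"
      unfolding v_def by (intro integrable_indicator_locally_integrable li) auto
    obtain e :: "nat \<Rightarrow> real" where e: "\<And>n. 0 < e n" "\<And>n. e n \<le> 1"
      "AE x in lborel. (\<lambda>n. mollify (e n) v x) \<longlonglongrightarrow> v x"
      using mollify_AE_subseq[OF v] by blast
    have eq: "mollify (e n) v x = mollify (e n) u x" if "x \<in> cball 0 (real k)" for n x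
      unfolding mollify_def
    proof (rule Bochner_Integration.integral_cong[OF refl])
      fix y
      show "mollifier (e n) (x - y) * v y = mollifier (e n) (x - y) * u y"
      proof (cases "norm (x - y) \<ge> e n")
        case False
        then have "norm y \<le> real k + 1"
          using that norm_triangle_ineq2[of y x] e(2)[of n] by (simp add: norm_minus_commute)
        then show ?thesis by (simp add: v_def)
      qed (simp add: mollifier_eq_0 e(1))
    qed
    have "(\<integral>\<^sup>+x. ?q (u x) * indicator (cball 0 (real k)) x \<partial>lborel)
        \<le> (\<integral>\<^sup>+x. liminf (\<lambda>n. ?q (mollify (e n) u x) * indicator (cball 0 (real k)) x) \<partial>lborel)"
    proof (rule nn_integral_mono_AE)
      show "AE x in lborel. ?q (u x) * indicator (cball 0 (real k)) x
          \<le> liminf (\<lambda>n. ?q (mollify (e n) u x) * indicator (cball 0 (real k)) x)"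
        using e(3)
      proof eventually_elim
        case (elim x)
        show ?case
        proof (cases "x \<in> cball 0 (real k)")
          case True
          then have "(\<lambda>n. mollify (e n) u x) \<longlonglongrightarrow> u x"
            using elim by (simp add: eq[OF True]) (simp add: v_def)
          then have "(\<lambda>n. ?q (mollify (e n) u x)) \<longlonglongrightarrow> ?q (u x)"
            using p by (intro tendsto_ennrealI tendsto_powr' tendsto_max) (auto intro!: always_eventually)
          from lim_imp_Liminf[OF _ this] show ?thesis using True by simp
        qed simp
      qed
    qed
    also have "\<dots> \<le> liminf (\<lambda>n. \<integral>\<^sup>+x. ?q (mollify (e n) u x) * indicator (cball 0 (real k)) x \<partial>lborel)"
      by (rule nn_integral_liminf) measurable
    also have "\<dots> \<le> liminf (\<lambda>n. C)"
    proof (intro Liminf_mono always_eventually allI)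
      fix n
      have "(\<integral>\<^sup>+x. ?q (mollify (e n) u x) * indicator (cball 0 (real k)) x \<partial>lborel)
         \<le> (\<integral>\<^sup>+x. ?q (mollify (e n) u x) \<partial>lborel)"
        by (intro nn_integral_mono) (auto simp: indicator_def)
      then show "(\<integral>\<^sup>+x. ?q (mollify (e n) u x) * indicator (cball 0 (real k)) x \<partial>lborel) \<le> C"
        using le[OF e(1)[of n]] by simp
    qed
    finally show ?thesis by (simp add: Liminf_const)
  qed
  have "(\<integral>\<^sup>+x. ?q (u x) \<partial>lborel) = (\<integral>\<^sup>+x. (SUP k. ?q (u x) * indicator (cball 0 (real k)) x) \<partial>lborel)"
  proof (intro nn_integral_cong antisym)
    fix x :: 'a
    obtain k where "norm x \<le> real k" using real_arch_simple by blast
    then show "?q (u x) \<le> (SUP k. ?q (u x) * indicator (cball 0 (real k)) x)"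
      by (intro SUP_upper2[of k]) auto
    show "(SUP k. ?q (u x) * indicator (cball 0 (real k)) x) \<le> ?q (u x)"
      by (intro SUP_least) (auto simp: indicator_def)
  qed
  also have "\<dots> = (SUP k. \<integral>\<^sup>+x. ?q (u x) * indicator (cball 0 (real k)) x \<partial>lborel)"
    by (intro nn_integral_monotone_convergence_SUP)
       (auto simp: incseq_def le_fun_def indicator_def)
  also have "\<dots> \<le> C" by (intro SUP_least ball)
  finally show ?thesis .
qed

section \<open>Increments and weak gradients\<close>

lemma locally_integrable_translate:
  fixes u :: "'a::euclidean_space \<Rightarrow> real"
  assumes [measurable]: "u \<in> borel_measurable borel" and "locally_integrable u"
  shows "locally_integrable (\<lambda>y. u (y + z))"
  unfolding locally_integrable_def set_integrable_def
proof (intro allI impI)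
  fix C :: "'a set" assume C: "compact C"
  then have [measurable]: "C \<in> sets borel" by (rule borel_compact)
  have "compact ((+) z ` C)" using C by (rule compact_translation)
  then have int: "integrable lborel (\<lambda>x. indicator ((+) z ` C) x * u x)"
    and [measurable]: "(+) z ` C \<in> sets borel"
    using assms by (auto intro: integrable_indicator_locally_integrable borel_compact)
  have "integrable (distr lborel borel ((+) z)) (\<lambda>x. indicator ((+) z ` C) x * u x)"
    using int by (simp only: lborel_distr_plus)
  then have "integrable lborel (\<lambda>y. indicator ((+) z ` C) (z + y) * u (z + y))"
    by (subst (asm) integrable_distr_eq) auto
  moreover have "indicator ((+) z ` C) (z + y) = (indicator C y :: real)" for y
    by (auto simp: indicator_def)
  ultimately have "integrable lborel (\<lambda>y. indicator C y *\<^sub>R u (y + z))"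
    by (simp add: add.commute)
  then show "integrable lebesgue (\<lambda>y. indicator C y *\<^sub>R u (y + z))"
    by (subst integrable_completion) auto
qed

lemma locally_integrable_diff:
  assumes "locally_integrable u" "locally_integrable v"
  shows "locally_integrable (\<lambda>y. u y - v y)"
  using assms by (simp add: locally_integrable_def set_integral_diff)

lemma locally_integrable_inner:
  fixes g :: "'a::euclidean_space \<Rightarrow> 'a"
  assumes "locally_integrable g"
  shows "locally_integrable (\<lambda>y. g y \<bullet> z)"
  unfolding locally_integrable_def set_integrable_def
proof (intro allI impI)
  fix C :: "'a set" assume "compact C"
  then have "integrable lebesgue (\<lambda>y. (indicator C y *\<^sub>R g y) \<bullet> z)"
    using assms by (intro integrable_inner_left) (auto simp: locally_integrable_def set_integrable_def)
  then show "integrable lebesgue (\<lambda>y. indicator C y *\<^sub>R (g y \<bullet> z))" by simp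
qed

text \<open>Dominated convergence for varying kernels that are uniformly bounded and live on one compact set. It
  serves both the continuity and the differentiability of mollifications.\<close>

lemma tendsto_integral_kernel:
  fixes u :: "'a::euclidean_space \<Rightarrow> real" and \<psi> :: "nat \<Rightarrow> 'a \<Rightarrow> real"
  assumes [measurable]: "u \<in> borel_measurable borel" and "locally_integrable u"
    and [measurable]: "\<And>n. \<psi> n \<in> borel_measurable borel" "\<psi>' \<in> borel_measurable borel"
    and bound: "\<And>n y. \<bar>\<psi> n y\<bar> \<le> B" and C: "compact C" "\<And>n y. \<psi> n y \<noteq> 0 \<Longrightarrow> y \<in> C"
    and lim: "\<And>y. (\<lambda>n. \<psi> n y) \<longlonglongrightarrow> \<psi>' y"
  shows "(\<lambda>n. LINT y|lborel. \<psi> n y * u y) \<longlonglongrightarrow> (LINT y|lborel. \<psi>' y * u y)"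
proof (rule integral_dominated_convergence[where w = "\<lambda>y. B * \<bar>indicator C y * u y\<bar>"])
  show "integrable lborel (\<lambda>y. B * \<bar>indicator C y * u y\<bar>)"
    using integrable_indicator_locally_integrable[OF assms(1,2) C(1)] by simp
  show "AE y in lborel. (\<lambda>n. \<psi> n y * u y) \<longlonglongrightarrow> \<psi>' y * u y"
    by (intro AE_I2 tendsto_intros lim)
  fix n
  show "AE y in lborel. norm (\<psi> n y * u y) \<le> B * \<bar>indicator C y * u y\<bar>"
  proof (intro AE_I2)
    fix y
    show "norm (\<psi> n y * u y) \<le> B * \<bar>indicator C y * u y\<bar>"
      using bound[of n y] C(2)[of n y]
      by (cases "\<psi> n y = 0") (auto simp: abs_mult intro!: mult_right_mono)
  qed
qed auto

text \<open>The derivative at \<open>w\<close> in direction \<open>z\<close>. The direction comes first, so that a fixed direction leaves a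
  function of the point.\<close>

definition mollifier_deriv :: "real \<Rightarrow> 'a::euclidean_space \<Rightarrow> 'a \<Rightarrow> real" where
  "mollifier_deriv e z w = frechet_derivative (mollifier e) (at w) z"

lemma smooth_expr_mollifier_self: "smooth_expr (mollifier e)"
  using smooth_expr_mollifier[where c = 1 and a = 0] by simp

lemma has_derivative_mollifier:
  "(mollifier e has_derivative (\<lambda>z. mollifier_deriv e z w)) (at w)"
  unfolding mollifier_deriv_def
  by (rule smooth_expr_frechet_derivative(1)[OF smooth_expr_mollifier_self])

lemma continuous_on_mollifier_deriv: "continuous_on A (mollifier_deriv e z)"
  unfolding mollifier_deriv_def[abs_def]
  by (intro continuous_on_smooth_expr smooth_expr_frechet_derivative(2) smooth_expr_mollifier_self)

lemma borel_measurable_mollifier_deriv [measurable]: "mollifier_deriv e z \<in> borel_measurable borel"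
  by (intro borel_measurable_continuous_onI continuous_on_mollifier_deriv)

lemma mollifier_deriv_eq_0:
  assumes "e > 0" "norm w > e"
  shows "mollifier_deriv e z w = 0"
proof -
  have "((\<lambda>_. 0) has_derivative (\<lambda>_. 0)) (at w)" by simp
  then have "(mollifier e has_derivative (\<lambda>_. 0)) (at w)"
  proof (rule has_derivative_transform_within_open)
    show "open (- cball 0 e)" "w \<in> - cball 0 e" using assms by auto
    show "0 = mollifier e x" if "x \<in> - cball 0 e" for x
      using that assms by (simp add: mollifier_eq_0)
  qed
  from has_derivative_unique[OF this has_derivative_mollifier] show ?thesis by metis
qed

lemma mollifier_deriv_bounded:
  assumes "e > 0"
  obtains B where "\<And>w. \<bar>mollifier_deriv e z w\<bar> \<le> B"
proof -
  have "compact (mollifier_deriv e z ` cball 0 e)"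
    by (intro compact_continuous_image continuous_on_mollifier_deriv) auto
  then obtain B where B: "\<And>w. w \<in> cball 0 e \<Longrightarrow> \<bar>mollifier_deriv e z w\<bar> \<le> B"
    using bounded_iff[of "mollifier_deriv e z ` cball 0 e"] compact_imp_bounded by fastforce
  have "\<bar>mollifier_deriv e z w\<bar> \<le> max 0 B" for w
    using B[of w] mollifier_deriv_eq_0[OF assms, of w z] by (cases "norm w \<le> e") auto
  then show ?thesis by (rule that)
qed

lemma mollifier_bounded:
  assumes "e > 0"
  obtains B where "\<And>w::'a::euclidean_space. \<bar>mollifier e w\<bar> \<le> B"
proof -
  have "compact (mollifier e ` cball (0::'a) e)"
    by (intro compact_continuous_image continuous_on_mollifier) auto
  then obtain B where B: "\<And>w::'a. w \<in> cball 0 e \<Longrightarrow> \<bar>mollifier e w\<bar> \<le> B"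
    using bounded_iff[of "mollifier e ` cball (0::'a) e"] compact_imp_bounded by fastforce
  have "\<bar>mollifier e w\<bar> \<le> max 0 B" for w :: 'a
    using B[of w] mollifier_eq_0[OF assms, of w] by (cases "norm w \<le> e") auto
  then show ?thesis by (rule that)
qed

lemma has_real_derivative_mollifier_line:
  "((\<lambda>t. mollifier e (a + t *\<^sub>R z)) has_real_derivative mollifier_deriv e z (a + t *\<^sub>R z)) (at t)"
proof -
  have "((\<lambda>t. a + t *\<^sub>R z) has_derivative (\<lambda>h. h *\<^sub>R z)) (at t)"
    by (auto intro!: derivative_eq_intros)
  from has_derivative_compose[OF this has_derivative_mollifier[of e]]
  have "((\<lambda>t. mollifier e (a + t *\<^sub>R z)) has_derivative
      (\<lambda>h. mollifier_deriv e (h *\<^sub>R z) (a + t *\<^sub>R z))) (at t)" .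
  moreover have "mollifier_deriv e (h *\<^sub>R z) w = mollifier_deriv e z w * h" for h w
    using linear_scale[OF has_derivative_linear[OF has_derivative_mollifier[of e w]], of h z]
    by (simp add: mult.commute)
  ultimately show ?thesis by (simp add: has_field_derivative_def)
qed

lemma continuous_on_mollify:
  fixes u :: "'a::euclidean_space \<Rightarrow> real"
  assumes "e > 0" and u: "u \<in> borel_measurable borel" "locally_integrable u"
  shows "continuous_on A (mollify e u)"
proof -
  have "continuous (at x) (mollify e u)" for x
    unfolding continuous_at_sequentially
  proof (intro allI impI)
    fix X assume X: "X \<longlonglongrightarrow> x"
    then obtain M where M: "\<And>n. norm (X n) \<le> M"
      using convergent_imp_bounded by (metis bounded_iff rangeI)
    obtain B where B: "\<And>w::'a. \<bar>mollifier e w\<bar> \<le> B" using mollifier_bounded[OF assms(1)] by blast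
    have "(\<lambda>n. LINT y|lborel. mollifier e (X n - y) * u y) \<longlonglongrightarrow> (LINT y|lborel. mollifier e (x - y) * u y)"
    proof (rule tendsto_integral_kernel[where C = "cball 0 (M + e)" and B = B, OF u])
      show "y \<in> cball 0 (M + e)" if "mollifier e (X n - y) \<noteq> 0" for n y
      proof -
        have "norm (X n - y) < e" using mollifier_eq_0[OF assms(1), of "X n - y"] that by force
        then show ?thesis using M[of n] norm_triangle_ineq2[of y "X n"] by (simp add: norm_minus_commute)
      qed
      show "(\<lambda>n. mollifier e (X n - y)) \<longlonglongrightarrow> mollifier e (x - y)" for y
        by (rule continuous_on_tendsto_compose[OF continuous_on_mollifier[of UNIV]])
           (auto intro!: tendsto_intros X)
    qed (use B in auto)
    then show "(mollify e u \<circ> X) \<longlonglongrightarrow> mollify e u x" by (simp add: mollify_def o_def)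
  qed
  then show ?thesis by (simp add: continuous_at_imp_continuous_on)
qed

text \<open>Testing the weak gradient with \<open>y \<mapsto> mollifier e (x - y)\<close> moves the derivative from the mollifier to \<open>f\<close>.
  The definition speaks of basis directions only; a general direction \<open>z\<close> follows by linearity.\<close>

lemma integral_mollifier_deriv_weak_gradient:
  fixes f :: "'a::euclidean_space \<Rightarrow> real"
  assumes wg: "has_weak_gradient f g"
    and f: "f \<in> borel_measurable borel" and g: "g \<in> borel_measurable borel" and e: "e > 0"
  shows "(LINT y|lborel. mollifier_deriv e z (x - y) * f y) = mollify e (\<lambda>y. g y \<bullet> z) x"
proof -
  note [measurable] = f g
  have lf: "locally_integrable f" and lg: "locally_integrable g"
    using wg by (auto simp: has_weak_gradient_def)
  have fd: "frechet_derivative (\<lambda>y. mollifier e (x - y)) (at y) i = - mollifier_deriv e i (x - y)" for y i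
  proof -
    have "((\<lambda>y. x - y) has_derivative (\<lambda>h. - h)) (at y)" by (auto intro!: derivative_eq_intros)
    from has_derivative_compose[OF this has_derivative_mollifier[of e]]
    have "frechet_derivative (\<lambda>y. mollifier e (x - y)) (at y) = (\<lambda>h. mollifier_deriv e (- h) (x - y))"
      by (rule frechet_derivative_at[symmetric])
    then show ?thesis
      using linear_neg[OF has_derivative_linear[OF has_derivative_mollifier[of e "x - y"]], of i] by simp
  qed
  have basis: "(LINT y|lborel. mollifier_deriv e i (x - y) * f y) = (LINT y|lborel. (g y \<bullet> i) * mollifier e (x - y))"
    if "i \<in> Basis" for i
  proof -
    have "(LINT y|lebesgue. f y * - mollifier_deriv e i (x - y)) = - (LINT y|lebesgue. (g y \<bullet> i) * mollifier e (x - y))"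
      using wg that test_function_mollifier[OF e, of x]
      unfolding has_weak_gradient_def fd[symmetric] by blast
    then show ?thesis
      by (subst (asm) (1 2) integral_completion) (auto simp: mult.commute)
  qed
  have int_f: "integrable lborel (\<lambda>y. mollifier_deriv e i (x - y) * f y)" for i
  proof (rule integrable_compact_support_mult[where C = "cball x e", OF f lf])
    show "continuous_on UNIV (\<lambda>y. mollifier_deriv e i (x - y))"
      by (intro continuous_on_compose2[OF continuous_on_mollifier_deriv[of UNIV]] continuous_intros) auto
    show "mollifier_deriv e i (x - y) \<noteq> 0 \<Longrightarrow> y \<in> cball x e" for y
      using mollifier_deriv_eq_0[OF e, of "x - y"] by (force simp: dist_norm)
  qed auto
  have int_g: "integrable lborel (\<lambda>y. mollifier e (x - y) * (g y \<bullet> i))" for i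
    by (intro integrable_mollifier_mult e locally_integrable_inner lg) auto
  have z: "(\<Sum>i\<in>Basis. (z \<bullet> i) *\<^sub>R i) = z" by (rule euclidean_representation)
  have "mollifier_deriv e z w = (\<Sum>i\<in>Basis. (z \<bullet> i) * mollifier_deriv e i w)" for w
  proof -
    have lin: "linear (\<lambda>z. mollifier_deriv e z w)"
      by (rule has_derivative_linear[OF has_derivative_mollifier])
    have "mollifier_deriv e (\<Sum>i\<in>Basis. (z \<bullet> i) *\<^sub>R i) w = (\<Sum>i\<in>Basis. (z \<bullet> i) * mollifier_deriv e i w)"
      by (simp add: linear_sum[OF lin] linear_scale[OF lin])
    then show ?thesis by (simp only: z)
  qed
  then have "(LINT y|lborel. mollifier_deriv e z (x - y) * f y)
      = (LINT y|lborel. (\<Sum>i\<in>Basis. (z \<bullet> i) * (mollifier_deriv e i (x - y) * f y)))"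
    by (simp add: sum_distrib_right mult.assoc)
  also have "\<dots> = (\<Sum>i\<in>Basis. (z \<bullet> i) * (LINT y|lborel. mollifier_deriv e i (x - y) * f y))"
    using int_f by (subst Bochner_Integration.integral_sum) auto
  also have "\<dots> = (\<Sum>i\<in>Basis. (z \<bullet> i) * (LINT y|lborel. mollifier e (x - y) * (g y \<bullet> i)))"
    by (intro sum.cong refl) (simp add: basis mult.commute[of "mollifier e _"])
  also have "\<dots> = (LINT y|lborel. (\<Sum>i\<in>Basis. (z \<bullet> i) * (mollifier e (x - y) * (g y \<bullet> i))))"
    using int_g by (subst Bochner_Integration.integral_sum) auto
  also have "\<dots> = (LINT y|lborel. mollifier e (x - y) * (g y \<bullet> z))"
  proof (intro Bochner_Integration.integral_cong refl)
    fix y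
    have "g y \<bullet> z = (\<Sum>i\<in>Basis. (g y \<bullet> i) * (z \<bullet> i))" by (rule euclidean_inner)
    then show "(\<Sum>i\<in>Basis. (z \<bullet> i) * (mollifier e (x - y) * (g y \<bullet> i))) = mollifier e (x - y) * (g y \<bullet> z)"
      by (simp add: sum_distrib_left mult_ac)
  qed
  finally show ?thesis by (simp add: mollify_def)
qed

text \<open>Mollification turns the weak gradient into a classical derivative. The difference quotients of the
  mollifier are bounded by the mean value theorem and supported in a common ball, so the derivative may be
  taken under the integral sign.\<close>

lemma has_real_derivative_mollify_line:
  fixes f :: "'a::euclidean_space \<Rightarrow> real"
  assumes wg: "has_weak_gradient f g"
    and f: "f \<in> borel_measurable borel" and g: "g \<in> borel_measurable borel" and e: "e > 0"
  shows "((\<lambda>t. mollify e f (x + t *\<^sub>R z)) has_real_derivative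
    mollify e (\<lambda>y. g y \<bullet> z) (x + t *\<^sub>R z)) (at t)"
proof -
  note [measurable] = f g
  have lf: "locally_integrable f" using wg by (auto simp: has_weak_gradient_def)
  define a where "a = x + t *\<^sub>R z"
  obtain B where B: "\<And>w. \<bar>mollifier_deriv e z w\<bar> \<le> B" using mollifier_deriv_bounded[OF e] by blast
  have lipschitz: "\<bar>mollifier e (w + h *\<^sub>R z) - mollifier e w\<bar> \<le> B * \<bar>h\<bar>" for w h
    using field_differentiable_bound[of UNIV "\<lambda>t. mollifier e (w + t *\<^sub>R z)"
        "\<lambda>t. mollifier_deriv e z (w + t *\<^sub>R z)" B h 0]
      has_real_derivative_mollifier_line B
    by (auto intro: has_field_derivative_at_within)
  have "((\<lambda>h. (mollify e f (a + h *\<^sub>R z) - mollify e f a) / h)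
      \<longlongrightarrow> mollify e (\<lambda>y. g y \<bullet> z) a) (at 0)"
    unfolding tendsto_at_iff_sequentially
  proof (intro allI impI)
    fix X assume X0: "\<forall>i. X i \<in> UNIV - {0::real}" and X: "X \<longlonglongrightarrow> 0"
    then obtain M where M: "\<And>n. \<bar>X n\<bar> \<le> M"
      using convergent_imp_bounded by (metis bounded_iff rangeI real_norm_def)
    let ?\<psi> = "\<lambda>n y. (mollifier e (a - y + X n *\<^sub>R z) - mollifier e (a - y)) / X n"
    have "(\<lambda>n. LINT y|lborel. ?\<psi> n y * f y) \<longlonglongrightarrow> (LINT y|lborel. mollifier_deriv e z (a - y) * f y)"
    \<comment> \<open>both mollifiers in the quotient vanish unless \<open>y\<close> is within \<open>e + M * norm z\<close> of \<open>a\<close>\<close>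
    proof (rule tendsto_integral_kernel[where C = "cball a (e + M * norm z)" and B = B, OF f lf])
      show "\<bar>?\<psi> n y\<bar> \<le> B" for n y
        using lipschitz[of "a - y" "X n"] X0 by (simp add: abs_divide divide_le_eq)
      show "y \<in> cball a (e + M * norm z)" if "?\<psi> n y \<noteq> 0" for n y
      proof -
        have "norm (a - y) < e + M * norm z"
        proof (cases "norm (a - y) < e")
          case True
          moreover have "0 \<le> M * norm z" using M[of 0] by (intro mult_nonneg_nonneg) auto
          ultimately show ?thesis by linarith
        next
          case False
          then have "norm (a - y + X n *\<^sub>R z) < e"
            using that mollifier_eq_0[OF e, of "a - y"] mollifier_eq_0[OF e, of "a - y + X n *\<^sub>R z"] by force
          moreover have "norm (X n *\<^sub>R z) \<le> M * norm z" using M[of n] by (simp add: mult_right_mono)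
          ultimately show ?thesis using norm_triangle_ineq4[of "a - y + X n *\<^sub>R z" "X n *\<^sub>R z"] by simp
        qed
        then show ?thesis by (simp add: dist_norm)
      qed
      show "(\<lambda>n. ?\<psi> n y) \<longlonglongrightarrow> mollifier_deriv e z (a - y)" for y
      proof -
        have "((\<lambda>h. (mollifier e (a - y + h *\<^sub>R z) - mollifier e (a - y)) / h)
            \<longlongrightarrow> mollifier_deriv e z (a - y)) (at 0)"
          using has_real_derivative_mollifier_line[of e "a - y" z 0] by (simp add: DERIV_def)
        from this[unfolded tendsto_at_iff_sequentially, rule_format, OF _ X] X0
        show ?thesis by (auto simp: o_def)
      qed
    qed auto
    moreover have "(LINT y|lborel. ?\<psi> n y * f y) = (mollify e f (a + X n *\<^sub>R z) - mollify e f a) / X n" for n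
    proof -
      have "?\<psi> n y * f y = (mollifier e (a + X n *\<^sub>R z - y) * f y - mollifier e (a - y) * f y) / X n" for y
        by (simp add: algebra_simps)
      then have "(LINT y|lborel. ?\<psi> n y * f y)
          = (LINT y|lborel. (mollifier e (a + X n *\<^sub>R z - y) * f y - mollifier e (a - y) * f y) / X n)"
        by (intro Bochner_Integration.integral_cong refl)
      also have "\<dots> = (mollify e f (a + X n *\<^sub>R z) - mollify e f a) / X n"
        unfolding mollify_def by (simp add: integrable_mollifier_mult[OF e f lf])
      finally show ?thesis .
    qed
    ultimately show "((\<lambda>h. (mollify e f (a + h *\<^sub>R z) - mollify e f a) / h) \<circ> X)
        \<longlonglongrightarrow> mollify e (\<lambda>y. g y \<bullet> z) a"
      by (simp only: o_def integral_mollifier_deriv_weak_gradient[OF wg f g e])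
  qed
  then show ?thesis by (simp add: DERIV_def a_def algebra_simps)
qed

definition diff_energy :: "real \<Rightarrow> ('a::euclidean_space \<Rightarrow> real) \<Rightarrow> 'a \<Rightarrow> ennreal" where
  "diff_energy p f z = (\<integral>\<^sup>+y. ennreal (max 0 (f (y + z) - f y) powr p) \<partial>lborel)"

definition grad_energy :: "real \<Rightarrow> ('a::euclidean_space \<Rightarrow> 'a) \<Rightarrow> 'a \<Rightarrow> ennreal" where
  "grad_energy p g z = (\<integral>\<^sup>+y. ennreal (max 0 (g y \<bullet> z) powr p) \<partial>lborel)"

text \<open>Convolution commutes with translations, hence with increments; this is what lets statements about
  \<open>diff_energy\<close> be transferred between a function and its mollifications.\<close>

lemma mollify_increment:
  fixes f :: "'a::euclidean_space \<Rightarrow> real"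
  assumes "e > 0" and f: "f \<in> borel_measurable borel" "locally_integrable f"
  shows "mollify e (\<lambda>y. f (y + z) - f y) x = mollify e f (x + z) - mollify e f x"
proof -
  note [measurable] = f(1)
  show ?thesis
    using mollify_diff[OF assms(1) _ locally_integrable_translate[OF f, of z] f] mollify_translate[OF f(1)]
    by simp
qed

lemma diff_energy_mollify_le:
  fixes f :: "'a::euclidean_space \<Rightarrow> real"
  assumes p: "p \<ge> 1" and e: "e > 0" and f: "f \<in> borel_measurable borel" "locally_integrable f"
  shows "diff_energy p (mollify e f) z \<le> diff_energy p f z"
proof -
  note [measurable] = f(1)
  show ?thesis
    using nn_integral_pos_powr_mollify_le[OF p e, of "\<lambda>y. f (y + z) - f y"]
      locally_integrable_diff[OF locally_integrable_translate[OF f, of z] f(2)]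
    by (simp add: diff_energy_def mollify_increment[OF e f])
qed

text \<open>The increment of the mollified function over \<open>z\<close> is the mean over \<open>t \<in> [0, 1]\<close> of its derivative in
  direction \<open>z\<close> at \<open>x + t z\<close>. Jensen's inequality bounds the energy of the mean by the mean of the energies,
  and these are all equal by translation invariance.\<close>

lemma diff_energy_mollify_le_grad_energy:
  fixes f :: "'a::euclidean_space \<Rightarrow> real"
  assumes wg: "has_weak_gradient f g"
    and f: "f \<in> borel_measurable borel" and g: "g \<in> borel_measurable borel"
    and e: "e > 0" and p: "p \<ge> 1"
  shows "diff_energy p (mollify e f) z \<le> grad_energy p g z"
proof -
  note [measurable] = f g
  define u where "u y = g y \<bullet> z" for y
  have [measurable]: "u \<in> borel_measurable borel" by (simp add: u_def[abs_def])
  have lu: "locally_integrable u" using wg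
    by (simp add: u_def[abs_def] has_weak_gradient_def locally_integrable_inner)
  let ?q = "\<lambda>t. ennreal (max 0 t powr p)"
  let ?I = "indicator {0..1} :: real \<Rightarrow> real"
  have pointwise: "?q (mollify e f (x + z) - mollify e f x)
      \<le> (\<integral>\<^sup>+t. ennreal (?I t * max 0 (mollify e u (x + t *\<^sub>R z)) powr p) \<partial>lborel)" for x
  proof -
    have cont: "continuous_on UNIV (\<lambda>t. mollify e u (x + t *\<^sub>R z))"
      by (intro continuous_on_compose2[OF continuous_on_mollify[of e u UNIV]] continuous_intros e lu) auto
    have "has_bochner_integral lborel (\<lambda>t. indicator {0..1} t *\<^sub>R mollify e u (x + t *\<^sub>R z))
        (mollify e f (x + 1 *\<^sub>R z) - mollify e f (x + 0 *\<^sub>R z))"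
    proof (rule has_bochner_integral_FTC_Icc[where F = "\<lambda>t. mollify e f (x + t *\<^sub>R z)"])
      show "((\<lambda>t. mollify e f (x + t *\<^sub>R z)) has_vector_derivative mollify e u (x + t *\<^sub>R z)) (at t within {0..1})" for t
        using has_real_derivative_mollify_line[OF wg f g e, of x z t]
        unfolding u_def[abs_def]
        by (auto intro: has_vector_derivative_at_within simp: has_real_derivative_iff_has_vector_derivative)
    qed (use cont in \<open>auto intro: continuous_on_subset\<close>)
    then have int: "integrable lborel (\<lambda>t. ?I t * mollify e u (x + t *\<^sub>R z))"
      and eq: "(LINT t|lborel. ?I t * mollify e u (x + t *\<^sub>R z)) = mollify e f (x + z) - mollify e f x"
      by (auto simp: has_bochner_integral_iff)
    show ?thesis
      unfolding eq[symmetric] by (rule jensen_pos_powr[OF p]) (use int in auto)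
  qed
  have "diff_energy p (mollify e f) z
      \<le> (\<integral>\<^sup>+x. (\<integral>\<^sup>+t. ennreal (?I t * max 0 (mollify e u (x + t *\<^sub>R z)) powr p) \<partial>lborel) \<partial>lborel)"
    unfolding diff_energy_def by (intro nn_integral_mono pointwise)
  also have "\<dots> = (\<integral>\<^sup>+t. (\<integral>\<^sup>+x. ennreal (?I t * max 0 (mollify e u (x + t *\<^sub>R z)) powr p) \<partial>lborel) \<partial>lborel)"
    by (intro lborel_pair.Fubini') measurable
  also have "\<dots> = (\<integral>\<^sup>+t. ennreal (?I t) * (\<integral>\<^sup>+x. ?q (mollify e u x) \<partial>lborel) \<partial>lborel)"
  proof (intro nn_integral_cong)
    fix t
    show "(\<integral>\<^sup>+x. ennreal (?I t * max 0 (mollify e u (x + t *\<^sub>R z)) powr p) \<partial>lborel)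
        = ennreal (?I t) * (\<integral>\<^sup>+x. ?q (mollify e u x) \<partial>lborel)"
      using nn_integral_translate[where h = "\<lambda>x. ?q (mollify e u x)" and a = "t *\<^sub>R z"]
      by (simp add: ennreal_mult' nn_integral_cmult add.commute)
  qed
  also have "\<dots> = (\<integral>\<^sup>+x. ?q (mollify e u x) \<partial>lborel)"
    by (simp add: nn_integral_multc ennreal_indicator)
  also have "\<dots> \<le> grad_energy p g z"
    using nn_integral_pos_powr_mollify_le[OF p e _ lu] by (simp add: grad_energy_def u_def)
  finally show ?thesis .
qed

text \<open>The bound for mollified functions holds uniformly in \<open>e\<close>, and the increments of the mollifications are
  the mollifications of the increment.\<close>

lemma diff_energy_le_grad_energy:
  fixes f :: "'a::euclidean_space \<Rightarrow> real"
  assumes wg: "has_weak_gradient f g"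
    and f: "f \<in> borel_measurable borel" and g: "g \<in> borel_measurable borel" and p: "p \<ge> 1"
  shows "diff_energy p f z \<le> grad_energy p g z"
  unfolding diff_energy_def
proof (rule nn_integral_pos_powr_le_if_mollify)
  note [measurable] = f
  have lf: "locally_integrable f" using wg by (simp add: has_weak_gradient_def)
  show "locally_integrable (\<lambda>y. f (y + z) - f y)"
    by (intro locally_integrable_diff locally_integrable_translate f lf)
  show "(\<lambda>y. f (y + z) - f y) \<in> borel_measurable borel" by measurable
  fix e :: real assume e: "e > 0"
  show "(\<integral>\<^sup>+x. ennreal (max 0 (mollify e (\<lambda>y. f (y + z) - f y) x) powr p) \<partial>lborel) \<le> grad_energy p g z"
    using diff_energy_mollify_le_grad_energy[OF wg f g e p, of z]
    by (simp add: diff_energy_def mollify_increment[OF e f lf])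
qed (use p in auto)

text \<open>For fixed \<open>e\<close> the difference quotients of the mollified function converge pointwise, so Fatou's lemma
  applies to \<open>t \<rightarrow> 0\<close>; mollification does not increase \<open>diff_energy\<close>, so the bound does not depend on \<open>e\<close>.\<close>

lemma grad_energy_le_liminf_diff_energy:
  fixes f :: "'a::euclidean_space \<Rightarrow> real"
  assumes wg: "has_weak_gradient f g"
    and f: "f \<in> borel_measurable borel" and g: "g \<in> borel_measurable borel" and p: "p \<ge> 1"
    and t: "\<And>n. t n > 0" "t \<longlonglongrightarrow> 0"
  shows "grad_energy p g z \<le> liminf (\<lambda>n. ennreal (t n powr - p) * diff_energy p f (t n *\<^sub>R z))"
  unfolding grad_energy_def
proof (rule nn_integral_pos_powr_le_if_mollify)
  note [measurable] = f g
  have lf: "locally_integrable f" and lg: "locally_integrable g"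
    using wg by (auto simp: has_weak_gradient_def)
  show "locally_integrable (\<lambda>y. g y \<bullet> z)" by (rule locally_integrable_inner[OF lg])
  show "(\<lambda>y. g y \<bullet> z) \<in> borel_measurable borel" by measurable
  fix e :: real assume e: "e > 0"
  let ?q = "\<lambda>t. ennreal (max 0 t powr p)"
  let ?d = "\<lambda>n x. mollify e f (x + t n *\<^sub>R z) - mollify e f x"
  have "(\<lambda>n. ?q (?d n x / t n)) \<longlonglongrightarrow> ?q (mollify e (\<lambda>y. g y \<bullet> z) x)" for x
  proof -
    have "((\<lambda>h. (mollify e f (x + h *\<^sub>R z) - mollify e f x) / h)
        \<longlongrightarrow> mollify e (\<lambda>y. g y \<bullet> z) x) (at 0)"
      using has_real_derivative_mollify_line[OF wg f g e, of x z 0] by (simp add: DERIV_def)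
    from this[unfolded tendsto_at_iff_sequentially, rule_format, of t] t
    have "(\<lambda>n. ?d n x / t n) \<longlonglongrightarrow> mollify e (\<lambda>y. g y \<bullet> z) x"
      by (auto simp: o_def less_imp_neq[THEN not_sym])
    then show ?thesis
      using p by (intro tendsto_ennrealI tendsto_powr' tendsto_max) (auto intro!: always_eventually)
  qed
  then have "(\<integral>\<^sup>+x. ?q (mollify e (\<lambda>y. g y \<bullet> z) x) \<partial>lborel) = (\<integral>\<^sup>+x. liminf (\<lambda>n. ?q (?d n x / t n)) \<partial>lborel)"
    by (intro nn_integral_cong lim_imp_Liminf[symmetric]) auto
  also have "\<dots> \<le> liminf (\<lambda>n. \<integral>\<^sup>+x. ?q (?d n x / t n) \<partial>lborel)"
    by (rule nn_integral_liminf) measurable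
  also have "\<dots> \<le> liminf (\<lambda>n. ennreal (t n powr - p) * diff_energy p f (t n *\<^sub>R z))"
  proof (intro Liminf_mono always_eventually allI)
    fix n
    have "max 0 (s / t n) powr p = t n powr - p * max 0 s powr p" for s
    proof -
      have "max 0 (s / t n) = max 0 s / t n" using t(1)[of n] by (auto simp: max_def divide_simps)
      moreover have "(max 0 s / t n) powr p = max 0 s powr p / t n powr p"
        by (rule powr_divide)
      ultimately show ?thesis by (simp add: powr_minus divide_inverse)
    qed
    then have "(\<integral>\<^sup>+x. ?q (?d n x / t n) \<partial>lborel) = ennreal (t n powr - p) * diff_energy p (mollify e f) (t n *\<^sub>R z)"
      by (simp add: ennreal_mult diff_energy_def nn_integral_cmult)
    then show "(\<integral>\<^sup>+x. ?q (?d n x / t n) \<partial>lborel) \<le> ennreal (t n powr - p) * diff_energy p f (t n *\<^sub>R z)"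
      using diff_energy_mollify_le[OF p e f lf] by (simp add: mult_left_mono)
  qed
  finally show "(\<integral>\<^sup>+x. ?q (mollify e (\<lambda>y. g y \<bullet> z) x) \<partial>lborel)
      \<le> liminf (\<lambda>n. ennreal (t n powr - p) * diff_energy p f (t n *\<^sub>R z))" .
qed (use p in auto)

section \<open>Gauges and radial integration\<close>

lemma gauge_mem_scale:
  fixes K :: "'a::real_vector set"
  assumes "l > 0"
  shows "z \<in> (*\<^sub>R) l ` K \<longleftrightarrow> inverse l *\<^sub>R z \<in> K"
  using assms by (force intro: image_eqI[where x = "inverse l *\<^sub>R z"])

lemma gauge_mem_mono:
  fixes K :: "'a::real_vector set"
  assumes "convex K" "0 \<in> K" "0 \<le> l" "l \<le> m" "z \<in> (*\<^sub>R) l ` K"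
  shows "z \<in> (*\<^sub>R) m ` K"
proof -
  obtain k where k: "k \<in> K" "z = l *\<^sub>R k" using assms(5) by auto
  show ?thesis
  proof (cases "m = 0")
    case False
    then have "m > 0" using assms by simp
    have "(1 - l / m) *\<^sub>R 0 + (l / m) *\<^sub>R k \<in> K"
      using assms \<open>m > 0\<close> k by (intro convexD) auto
    then have "inverse m *\<^sub>R z \<in> K" by (simp add: k divide_inverse mult.commute)
    then show ?thesis using \<open>m > 0\<close> by (simp add: gauge_mem_scale)
  qed (use assms in auto)
qed

text \<open>Since \<open>K\<close> contains a ball around 0, every point lies in some dilate of \<open>K\<close>; this excludes the unspecified
  infimum of the empty set.\<close>

lemma gauge_set_nonempty:
  fixes K :: "'a::euclidean_space set"
  assumes "0 \<in> interior K"
  shows "\<exists>l\<ge>0. z \<in> (*\<^sub>R) l ` K"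
proof -
  obtain r where r: "r > 0" "ball 0 r \<subseteq> K" using assms by (auto simp: mem_interior)
  define l where "l = (norm z + 1) / r"
  have l: "l > 0" using r by (simp add: l_def add_nonneg_pos)
  have "norm (inverse l *\<^sub>R z) < r"
    using r l by (simp add: l_def field_simps add_nonneg_pos)
  then have "inverse l *\<^sub>R z \<in> K" using r by auto
  then show ?thesis using l gauge_mem_scale[OF l] by (intro exI[of _ l]) auto
qed

lemma minkowski_nonneg:
  fixes K :: "'a::euclidean_space set"
  assumes "0 \<in> interior K"
  shows "minkowski K z \<ge> 0"
  unfolding minkowski_def
  by (rule cInf_greatest) (use gauge_set_nonempty[OF assms, of z] in auto)

text \<open>The dilates of \<open>K\<close> increase with the factor, so \<open>z\<close> lies in \<open>m K\<close> for every \<open>m > l\<close>; closedness of \<open>K\<close> gives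
  the case \<open>m = l\<close>, i.e. the infimum is attained.\<close>

lemma minkowski_le_iff:
  fixes K :: "'a::euclidean_space set"
  assumes K: "compact K" "convex K" "0 \<in> interior K" and l: "l > 0"
  shows "minkowski K z \<le> l \<longleftrightarrow> inverse l *\<^sub>R z \<in> K"
proof
  let ?S = "{l. l \<ge> 0 \<and> z \<in> (*\<^sub>R) l ` K}"
  have bdd: "bdd_below ?S" by (intro bdd_belowI[where m = 0]) auto
  have ne: "?S \<noteq> {}" using gauge_set_nonempty[OF K(3), of z] by auto
  have K0: "0 \<in> K" using K(3) interior_subset by blast
  show "minkowski K z \<le> l" if "inverse l *\<^sub>R z \<in> K"
    unfolding minkowski_def using that l by (intro cInf_lower bdd) (auto simp: gauge_mem_scale)
  assume le: "minkowski K z \<le> l"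
  have in_K: "inverse m *\<^sub>R z \<in> K" if "m > l" for m
  proof -
    have "Inf ?S < m" using le that by (simp add: minkowski_def)
    then obtain k where k: "k \<in> ?S" "k < m" using cInf_lessD[OF ne] by blast
    then have "z \<in> (*\<^sub>R) m ` K" using K(2) K0 by (intro gauge_mem_mono[of K k m]) auto
    moreover have "m > 0" using that l by simp
    ultimately show ?thesis using gauge_mem_scale[of m z K] by blast
  qed
  have "(\<lambda>n. inverse (l + inverse (real (Suc n))) *\<^sub>R z) \<longlonglongrightarrow> inverse (l + 0) *\<^sub>R z"
    using l by (intro tendsto_intros LIMSEQ_inverse_real_of_nat) auto
  then have "inverse (l + 0) *\<^sub>R z \<in> K"
    by (rule closed_sequentially[OF compact_imp_closed[OF K(1)], rotated])
       (auto intro!: in_K)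
  then show "inverse l *\<^sub>R z \<in> K" by simp
qed

lemma minkowski_pos:
  fixes K :: "'a::euclidean_space set"
  assumes K: "compact K" "0 \<in> interior K" and z: "z \<noteq> 0"
  shows "minkowski K z > 0"
proof -
  obtain B where B: "B > 0" "\<And>k. k \<in> K \<Longrightarrow> norm k \<le> B"
    using compact_imp_bounded[OF K(1)] by (auto simp: bounded_pos)
  have "norm z / B \<le> minkowski K z"
    unfolding minkowski_def
  proof (rule cInf_greatest)
    show "{l. l \<ge> 0 \<and> z \<in> (*\<^sub>R) l ` K} \<noteq> {}" using gauge_set_nonempty[OF K(2), of z] by auto
    fix l assume "l \<in> {l. l \<ge> 0 \<and> z \<in> (*\<^sub>R) l ` K}"
    then obtain k where "l \<ge> 0" "k \<in> K" "z = l *\<^sub>R k" by auto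
    then show "norm z / B \<le> l" using B by (simp add: divide_le_eq mult_left_mono)
  qed
  moreover have "norm z / B > 0" using z B by simp
  ultimately show ?thesis by linarith
qed

text \<open>Sublevel sets at positive heights are dilates of \<open>K\<close>; height 0 is their intersection.\<close>

lemma borel_measurable_minkowski:
  fixes K :: "'a::euclidean_space set"
  assumes K: "compact K" "convex K" "0 \<in> interior K"
  shows "minkowski K \<in> borel_measurable borel"
  unfolding borel_measurable_iff_le
proof (intro allI)
  have [measurable]: "K \<in> sets borel" using K(1) by (rule borel_compact)
  have pos: "{z. minkowski K z \<le> l} \<in> sets borel" if "l > 0" for l
    using that by (simp add: minkowski_le_iff[OF K])
  have zero: "minkowski K z \<le> 0 \<longleftrightarrow> (\<forall>n. minkowski K z \<le> inverse (real (Suc n)))" for z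
  proof
    assume *: "\<forall>n. minkowski K z \<le> inverse (real (Suc n))"
    show "minkowski K z \<le> 0"
      by (rule LIMSEQ_le_const[OF LIMSEQ_inverse_real_of_nat]) (use * in auto)
  qed (auto intro: order_trans)
  fix a :: real
  consider "a > 0" | "a = 0" | "a < 0" by linarith
  then show "{w \<in> space borel. minkowski K w \<le> a} \<in> sets borel"
  proof cases
    case 2
    have "{z. minkowski K z \<le> 0} = (\<Inter>n. {z. minkowski K z \<le> inverse (real (Suc n))})"
      using zero by blast
    also have "\<dots> \<in> sets borel" by (intro sets.countable_INT'' pos) auto
    finally show ?thesis using 2 by simp
  next
    case 3
    then have "{w. minkowski K w \<le> a} = {}" using minkowski_nonneg[OF K(3)]
      by (auto simp: not_le intro: less_le_trans)
    then show ?thesis by simp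
  qed (use pos in simp)
qed

lemma powr_layer_cake:
  fixes a r :: real
  assumes "a > 0" "r > 0"
  shows "(\<integral>\<^sup>+l. ennreal (a * l powr (- a - 1)) * indicator {r..} l \<partial>lborel) = ennreal (r powr - a)"
proof -
  have "((\<lambda>l. - (l powr - a)) \<longlongrightarrow> - 0) at_top"
    using assms by (intro tendsto_minus tendsto_neg_powr filterlim_ident) auto
  moreover have "DERIV (\<lambda>l. - (l powr - a)) x :> a * x powr (- a - 1)" if "r \<le> x" for x
    using assms that by (auto intro!: derivative_eq_intros)
  ultimately have "(\<integral>\<^sup>+l. ennreal (a * l powr (- a - 1)) * indicator {r..} l \<partial>lborel)
      = ennreal (- 0 - - (r powr - a))"
    using assms by (intro nn_integral_FTC_atLeast[where F = "\<lambda>l. - (l powr - a)"]) auto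
  then show ?thesis by simp
qed

lemma gauge_layer_cake:
  fixes K :: "'a::euclidean_space set"
  assumes K: "compact K" "convex K" "0 \<in> interior K" and a: "a > 0" and z: "z \<noteq> 0"
  shows "ennreal (inverse (minkowski K z powr a))
    = (\<integral>\<^sup>+l. ennreal (a * l powr (- a - 1)) * indicator {0<..} l * indicator K (inverse l *\<^sub>R z) \<partial>lborel)"
proof -
  have pos: "minkowski K z > 0" by (rule minkowski_pos[OF K(1,3) z])
  have "indicator {0<..} l * indicator K (inverse l *\<^sub>R z) = (indicator {minkowski K z..} l :: ennreal)" for l
    using pos minkowski_le_iff[OF K, of l z] by (auto simp: indicator_def)
  then show ?thesis
    using powr_layer_cake[OF a pos] by (simp add: powr_minus mult.assoc)
qed

lemma nn_integral_scale:
  fixes h :: "'a::euclidean_space \<Rightarrow> ennreal"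
  assumes [measurable]: "h \<in> borel_measurable borel" and "l > 0"
  shows "(\<integral>\<^sup>+z. h z \<partial>lborel) = ennreal (l powr real DIM('a)) * (\<integral>\<^sup>+w. h (l *\<^sub>R w) \<partial>lborel)"
  using assms(2)
  by (subst lborel_affine[of l 0])
     (simp_all add: nn_integral_density nn_integral_distr nn_integral_cmult powr_realpow)

text \<open>The integral of \<open>F\<close> over the dilate \<open>l K\<close>, pulled back to \<open>K\<close> and divided by \<open>l powr p\<close>, because
  \<open>grad_energy\<close> is homogeneous of degree \<open>p\<close>. For \<open>F\<close> of this homogeneity it does not depend on \<open>l > 0\<close>.\<close>

definition scaled_energy :: "real \<Rightarrow> 'a::euclidean_space set \<Rightarrow> ('a \<Rightarrow> ennreal) \<Rightarrow> real \<Rightarrow> ennreal" where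
  "scaled_energy p K F l = (\<integral>\<^sup>+w. ennreal (l powr - p) * F (l *\<^sub>R w) * indicator K w \<partial>lborel)"

lemma borel_measurable_scaled_energy [measurable]:
  assumes [measurable]: "F \<in> borel_measurable borel" "K \<in> sets borel"
  shows "scaled_energy p K F \<in> borel_measurable borel"
  unfolding scaled_energy_def[abs_def] by measurable

text \<open>Insert the layer cake formula for the kernel, exchange the integrals, and substitute \<open>z = l w\<close> in the
  inner one. The Jacobian contributes \<open>l powr n\<close>, the normalisation of \<open>scaled_energy\<close> contributes
  \<open>l powr p\<close>.\<close>

lemma nn_integral_gauge_kernel:
  fixes K :: "'a::euclidean_space set" and F :: "'a \<Rightarrow> ennreal"
  assumes K: "compact K" "convex K" "0 \<in> interior K" and a: "a > 0"
    and [measurable]: "F \<in> borel_measurable borel"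
  shows "(\<integral>\<^sup>+z. F z * ennreal (inverse (minkowski K z powr a)) \<partial>lborel)
    = (\<integral>\<^sup>+l. ennreal (a * l powr (real DIM('a) + p - a - 1)) * scaled_energy p K F l * indicator {0<..} l \<partial>lborel)"
proof -
  have [measurable]: "K \<in> sets borel" using K(1) by (rule borel_compact)
  have "(\<integral>\<^sup>+z. F z * ennreal (inverse (minkowski K z powr a)) \<partial>lborel)
      = (\<integral>\<^sup>+z. (\<integral>\<^sup>+l. F z * (ennreal (a * l powr (- a - 1)) * indicator {0<..} l
          * indicator K (inverse l *\<^sub>R z)) \<partial>lborel) \<partial>lborel)"
  proof (rule nn_integral_cong_AE)
    \<comment> \<open>at 0 the kernel has the default value 0, whereas its layer cake integral is infinite\<close>
    have "AE z in lborel. z \<noteq> (0::'a)" by (rule AE_lborel_singleton)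
    then show "AE z in lborel. F z * ennreal (inverse (minkowski K z powr a))
        = (\<integral>\<^sup>+l. F z * (ennreal (a * l powr (- a - 1)) * indicator {0<..} l
          * indicator K (inverse l *\<^sub>R z)) \<partial>lborel)"
      by eventually_elim (simp add: gauge_layer_cake[OF K a] nn_integral_cmult)
  qed
  also have "\<dots> = (\<integral>\<^sup>+l. (\<integral>\<^sup>+z. F z * (ennreal (a * l powr (- a - 1)) * indicator {0<..} l
          * indicator K (inverse l *\<^sub>R z)) \<partial>lborel) \<partial>lborel)"
    by (intro lborel_pair.Fubini') measurable
  also have "\<dots> = (\<integral>\<^sup>+l. ennreal (a * l powr (real DIM('a) + p - a - 1)) * scaled_energy p K F l
      * indicator {0<..} l \<partial>lborel)"
  proof (intro nn_integral_cong)
    fix l :: real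
    show "(\<integral>\<^sup>+z. F z * (ennreal (a * l powr (- a - 1)) * indicator {0<..} l
          * indicator K (inverse l *\<^sub>R z)) \<partial>lborel)
      = ennreal (a * l powr (real DIM('a) + p - a - 1)) * scaled_energy p K F l * indicator {0<..} l"
    proof (cases "l > 0")
      case True
      have "a * l powr (real DIM('a) + p - a - 1) * l powr - p
          = a * (l powr (real DIM('a) + p - a - 1) * l powr - p)" by simp
      also have "l powr (real DIM('a) + p - a - 1) * l powr - p = l powr real DIM('a) * l powr (- a - 1)"
        by (simp flip: powr_add)
      finally have e: "ennreal (a * l powr (real DIM('a) + p - a - 1)) * ennreal (l powr - p)
          = ennreal (l powr real DIM('a)) * ennreal (a * l powr (- a - 1))"
        using a by (simp add: mult_ac flip: ennreal_mult)
      have "(\<integral>\<^sup>+z. F z * (ennreal (a * l powr (- a - 1)) * indicator {0<..} l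
          * indicator K (inverse l *\<^sub>R z)) \<partial>lborel)
        = ennreal (a * l powr (- a - 1)) * (\<integral>\<^sup>+z. F z * indicator K (inverse l *\<^sub>R z) \<partial>lborel)"
        using True by (simp add: mult_ac flip: nn_integral_cmult)
      also have "(\<integral>\<^sup>+z. F z * indicator K (inverse l *\<^sub>R z) \<partial>lborel)
        = ennreal (l powr real DIM('a)) * (\<integral>\<^sup>+w. F (l *\<^sub>R w) * indicator K w \<partial>lborel)"
        using True by (subst nn_integral_scale[of _ l]) auto
      also have "ennreal (a * l powr (- a - 1)) * \<dots>
        = (ennreal (l powr real DIM('a)) * ennreal (a * l powr (- a - 1)))
            * (\<integral>\<^sup>+w. F (l *\<^sub>R w) * indicator K w \<partial>lborel)" by (simp only: mult_ac)
      also have "\<dots> = ennreal (a * l powr (real DIM('a) + p - a - 1)) * scaled_energy p K F l"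
        unfolding e[symmetric] scaled_energy_def by (simp add: nn_integral_cmult mult.assoc)
      finally show ?thesis using True by simp
    qed simp
  qed
  finally show ?thesis .
qed

lemma nn_integral_powr_atMost:
  fixes b d :: real
  assumes "b > 0" "d > 0"
  shows "(\<integral>\<^sup>+l. ennreal (l powr (b - 1)) * indicator {0<..d} l \<partial>lborel) = ennreal (d powr b / b)"
proof -
  have "((\<lambda>l. l powr (b - 1)) has_integral (d powr b / b)) {0..d}"
    using has_integral_powr_from_0[of "b - 1" d] assms by simp
  then have "((\<lambda>l. if l \<in> {0..d} then l powr (b - 1) else 0) has_integral (d powr b / b)) UNIV"
    by (simp only: has_integral_restrict_UNIV)
  also have "(\<lambda>l. if l \<in> {0..d} then l powr (b - 1) else 0) = (\<lambda>l. l powr (b - 1) * indicator {0..d} l)"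
    by (auto simp: fun_eq_iff)
  finally have "((\<lambda>l. l powr (b - 1) * indicator {0..d} l) has_integral (d powr b / b)) UNIV" .
  then have "(\<integral>\<^sup>+l. ennreal (l powr (b - 1) * indicator {0..d} l) \<partial>lborel) = ennreal (d powr b / b)"
    by (intro nn_integral_has_integral_lborel) auto
  moreover have "ennreal (l powr (b - 1) * indicator {0..d} l) = ennreal (l powr (b - 1)) * indicator {0<..d} l" for l
    by (cases "l = 0") (auto simp: indicator_def)
  ultimately show ?thesis by simp
qed

text \<open>With \<open>b = p (1 - s)\<close>, the weight \<open>l powr (b - 1)\<close> has mass \<open>d powr b / b\<close> on \<open>(0, d]\<close>, and \<open>1 - s = b / p\<close>
  cancels the factor \<open>1 / b\<close>. For the upper bound, use \<open>N \<le> M\<close> on \<open>(0, 1]\<close> and the decay of \<open>N\<close> beyond 1, where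
  the contribution is \<open>O(1 - s)\<close>. For the lower bound, keep only an interval \<open>(0, d]\<close> on which \<open>N\<close> exceeds a
  given \<open>c < M\<close>; its mass tends to that of the whole, as \<open>d powr b\<close> tends to 1. The value \<open>M = \<infinity>\<close> is allowed.\<close>

lemma radial_limit:
  fixes N :: "real \<Rightarrow> ennreal" and p n :: real
  assumes [measurable]: "N \<in> borel_measurable borel" and p: "p > 0" and n: "n \<ge> 0"
    and le: "\<And>l. l > 0 \<Longrightarrow> N l \<le> M"
    and decay: "\<And>l. l > 0 \<Longrightarrow> N l \<le> ennreal (l powr - p) * C" and C: "C < \<infinity>"
    and lower: "\<And>c. c < M \<Longrightarrow> \<forall>\<^sub>F l in at_right 0. c < N l"
  shows "((\<lambda>s. ennreal (1 - s) * (\<integral>\<^sup>+l. ennreal ((n + s * p) * l powr (p * (1 - s) - 1)) * N l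
      * indicator {0<..} l \<partial>lborel)) \<longlongrightarrow> ennreal ((n + p) / p) * M) (at_left 1)"
    (is "(?I \<longlongrightarrow> _) _")
proof -
  let ?w = "\<lambda>s l. ennreal ((n + s * p) * l powr (p * (1 - s) - 1))"
  let ?U = "\<lambda>s. ennreal ((n + s * p) / p) * M + ennreal ((1 - s) * (n + s * p) / (s * p)) * C"
  have s01: "\<forall>\<^sub>F s in at_left 1. 0 < s \<and> s < (1::real)"
    using eventually_at_left_real[of 0 1] by simp
  have upper: "?I s \<le> ?U s" if s: "0 < s" "s < 1" for s
  proof -
    have b: "p * (1 - s) > 0" "s * p > 0" using p s by auto
    have "(\<integral>\<^sup>+l. ?w s l * N l * indicator {0<..} l \<partial>lborel)
      \<le> (\<integral>\<^sup>+l. ennreal (n + s * p) * M * (ennreal (l powr (p * (1 - s) - 1)) * indicator {0<..1} l)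
          + ennreal ((n + s * p) / (s * p)) * C * (ennreal (s * p * l powr (- (s * p) - 1)) * indicator {1..} l) \<partial>lborel)"
    proof (rule nn_integral_mono)
      fix l :: real
      consider "l \<le> 0" | "0 < l" "l \<le> 1" | "l > 1" by linarith
      then show "?w s l * N l * indicator {0<..} l
        \<le> ennreal (n + s * p) * M * (ennreal (l powr (p * (1 - s) - 1)) * indicator {0<..1} l)
          + ennreal ((n + s * p) / (s * p)) * C * (ennreal (s * p * l powr (- (s * p) - 1)) * indicator {1..} l)"
      proof cases
        case 2
        then have "?w s l * N l * indicator {0<..} l
            \<le> ennreal (n + s * p) * M * (ennreal (l powr (p * (1 - s) - 1)) * indicator {0<..1} l)"
          using le[of l] b n by (simp add: ennreal_mult mult_ac mult_left_mono mult_right_mono)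
        then show ?thesis by (rule order_trans) simp
      next
        case 3
        then have "?w s l * N l * indicator {0<..} l \<le> ?w s l * (ennreal (l powr - p) * C)"
          using decay[of l] by (simp add: mult_left_mono)
        also have "\<dots> = ?w s l * ennreal (l powr - p) * C" by (simp only: mult.assoc)
        also have "?w s l * ennreal (l powr - p) = ennreal ((n + s * p) * (l powr (p * (1 - s) - 1) * l powr - p))"
          using b n by (subst ennreal_mult[symmetric]) (auto simp: mult.assoc)
        also have "l powr (p * (1 - s) - 1) * l powr - p = l powr (- (s * p) - 1)"
          unfolding powr_add[symmetric]
          by (rule arg_cong[where f = "\<lambda>x. l powr x"]) (simp add: algebra_simps)
        also have "ennreal ((n + s * p) * l powr (- (s * p) - 1))
            = ennreal ((n + s * p) / (s * p)) * ennreal (s * p * l powr (- (s * p) - 1))"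
          using b n s p by (simp flip: ennreal_mult)
        finally show ?thesis using 3 by (simp add: mult_ac)
      qed simp
    qed
    also have "\<dots> = ennreal (n + s * p) * M * ennreal (1 / (p * (1 - s))) + ennreal ((n + s * p) / (s * p)) * C"
      using nn_integral_powr_atMost[OF b(1), of 1] powr_layer_cake[OF b(2), of 1]
      by (simp add: nn_integral_add nn_integral_cmult)
    finally have "?I s \<le> ennreal (1 - s) * (ennreal (n + s * p) * M * ennreal (1 / (p * (1 - s)))
        + ennreal ((n + s * p) / (s * p)) * C)" by (rule mult_left_mono) simp
    also have "\<dots> = (ennreal (1 - s) * ennreal (n + s * p) * ennreal (1 / (p * (1 - s)))) * M
        + (ennreal (1 - s) * ennreal ((n + s * p) / (s * p))) * C"
      by (simp only: distrib_left mult_ac)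
    also have "\<dots> = ?U s"
    proof -
      have "ennreal (1 - s) * ennreal (n + s * p) * ennreal (1 / (p * (1 - s))) = ennreal ((n + s * p) / p)"
      proof -
        have nn: "0 \<le> 1 - s" "0 \<le> (1 - s) * (n + s * p)" using s b n by auto
        have "ennreal (1 - s) * ennreal (n + s * p) * ennreal (1 / (p * (1 - s)))
            = ennreal ((1 - s) * (n + s * p) * (1 / (p * (1 - s))))"
          by (simp only: ennreal_mult'[OF nn(2)] ennreal_mult'[OF nn(1)])
        also have "(1 - s) * (n + s * p) * (1 / (p * (1 - s))) = (n + s * p) / p"
          using s by simp
        finally show ?thesis .
      qed
      moreover have "ennreal (1 - s) * ennreal ((n + s * p) / (s * p)) = ennreal ((1 - s) * (n + s * p) / (s * p))"
        using s b n by (subst ennreal_mult[symmetric]) auto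
      ultimately show ?thesis by simp
    qed
    finally show ?thesis .
  qed
  have k: "(n + p) / p > 0" using p n by simp
  have "(?U \<longlongrightarrow> ennreal ((n + 1 * p) / p) * M + ennreal ((1 - 1) * (n + 1 * p) / (1 * p)) * C) (at_left 1)"
    using p n C by (intro tendsto_add tendsto_mult_ennreal tendsto_ennrealI tendsto_intros) auto
  then have U: "(?U \<longlongrightarrow> ennreal ((n + p) / p) * M) (at_left 1)" by simp
  show ?thesis
  proof (rule order_tendstoI)
    fix a assume a: "ennreal ((n + p) / p) * M < a"
    from order_tendstoD(2)[OF U this] s01 show "\<forall>\<^sub>F s in at_left 1. ?I s < a"
      by eventually_elim (blast intro: le_less_trans upper)
  next
    fix a assume a: "a < ennreal ((n + p) / p) * M"
    then have "a / ennreal ((n + p) / p) < M"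
      using k by (subst divide_less_ennreal) (auto simp: mult.commute)
    then obtain c where c: "a / ennreal ((n + p) / p) < c" "c < M" using dense by blast
    then have ac: "a < ennreal ((n + p) / p) * c"
      using k by (subst (asm) divide_less_ennreal) (auto simp: mult.commute)
    have cfin: "c < \<infinity>" using c(2) top.not_eq_extremum by fastforce
    obtain d' where d': "d' > 0" "\<And>l. 0 < l \<Longrightarrow> l < d' \<Longrightarrow> c < N l"
      using lower[OF c(2)] by (auto simp: eventually_at_right_field)
    \<comment> \<open>halving turns the open interval into one that is closed at its right end\<close>
    define d where "d = d' / 2"
    have d: "d > 0" "\<And>l. 0 < l \<Longrightarrow> l \<le> d \<Longrightarrow> c \<le> N l"
      using d' by (auto simp: d_def intro!: less_imp_le[OF d'(2)])
    let ?L = "\<lambda>s. ennreal ((n + s * p) / p * d powr (p * (1 - s))) * c"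
    have "(?L \<longlongrightarrow> ennreal ((n + 1 * p) / p * d powr (p * (1 - 1))) * c) (at_left 1)"
      using p n d cfin by (intro tendsto_mult_ennreal tendsto_ennrealI tendsto_intros) auto
    then have "(?L \<longlongrightarrow> ennreal ((n + p) / p) * c) (at_left 1)" using d by simp
    from order_tendstoD(1)[OF this ac] s01 show "\<forall>\<^sub>F s in at_left 1. a < ?I s"
    proof eventually_elim
      case (elim s)
      then have s: "0 < s" "s < 1" by auto
      then have b: "p * (1 - s) > 0" "s * p > 0" using p by auto
      have "?L s = ennreal (1 - s) * (ennreal (n + s * p) * c * ennreal (d powr (p * (1 - s)) / (p * (1 - s))))"
      proof -
        have nn: "0 \<le> 1 - s" "0 \<le> (1 - s) * (n + s * p)" using s b n by auto
        have "(n + s * p) / p * d powr (p * (1 - s))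
            = (1 - s) * (n + s * p) * (d powr (p * (1 - s)) / (p * (1 - s)))"
          using s by simp
        also have "ennreal \<dots>
          = ennreal (1 - s) * ennreal (n + s * p) * ennreal (d powr (p * (1 - s)) / (p * (1 - s)))"
          by (simp only: ennreal_mult'[OF nn(2)] ennreal_mult'[OF nn(1)])
        finally have eq: "ennreal ((n + s * p) / p * d powr (p * (1 - s)))
          = ennreal (1 - s) * ennreal (n + s * p) * ennreal (d powr (p * (1 - s)) / (p * (1 - s)))" .
        show ?thesis unfolding eq by (simp only: mult_ac)
      qed
      moreover have "ennreal (n + s * p) * c * ennreal (d powr (p * (1 - s)) / (p * (1 - s)))
         = (\<integral>\<^sup>+l. ennreal (n + s * p) * c * (ennreal (l powr (p * (1 - s) - 1)) * indicator {0<..d} l) \<partial>lborel)"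
        by (simp add: nn_integral_cmult nn_integral_powr_atMost[OF b(1) d(1)])
      moreover have "(\<integral>\<^sup>+l. ennreal (n + s * p) * c * (ennreal (l powr (p * (1 - s) - 1)) * indicator {0<..d} l) \<partial>lborel)
        \<le> (\<integral>\<^sup>+l. ?w s l * N l * indicator {0<..} l \<partial>lborel)"
      proof (rule nn_integral_mono)
        fix l :: real
        show "ennreal (n + s * p) * c * (ennreal (l powr (p * (1 - s) - 1)) * indicator {0<..d} l)
            \<le> ?w s l * N l * indicator {0<..} l"
        proof (cases "0 < l \<and> l \<le> d")
          case True
          then show ?thesis
            using d(2)[of l] b n by (simp add: ennreal_mult mult_ac mult_left_mono mult_right_mono)
        qed (auto simp: indicator_def)
      qed
      ultimately have "?L s \<le> ?I s" by (simp only: mult_left_mono zero_le)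
      with elim(1) show ?case by (rule less_le_trans)
    qed
  qed
qed

section \<open>The limit\<close>

lemma borel_measurable_diff_energy [measurable]:
  assumes [measurable]: "f \<in> borel_measurable borel"
  shows "diff_energy p f \<in> borel_measurable borel"
  unfolding diff_energy_def[abs_def] by measurable

lemma borel_measurable_grad_energy [measurable]:
  assumes [measurable]: "g \<in> borel_measurable borel"
  shows "grad_energy p g \<in> borel_measurable borel"
  unfolding grad_energy_def[abs_def] by measurable

text \<open>A bound independent of \<open>z\<close>; after scaling it makes \<open>scaled_energy\<close> decay like \<open>l powr (- p)\<close>, which
  controls large increments.\<close>

lemma diff_energy_bound:
  fixes f :: "'a::euclidean_space \<Rightarrow> real"
  assumes p: "p \<ge> 0" and [measurable]: "f \<in> borel_measurable borel"
  shows "diff_energy p f z \<le> ennreal (2 powr p) * (2 * (\<integral>\<^sup>+x. ennreal (\<bar>f x\<bar> powr p) \<partial>lborel))"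
proof -
  have pw: "max 0 (a - b) powr p \<le> 2 powr p * (\<bar>a\<bar> powr p + \<bar>b\<bar> powr p)" for a b :: real
  proof -
    have "max 0 (a - b) powr p \<le> (2 * max \<bar>a\<bar> \<bar>b\<bar>) powr p"
      using p by (intro powr_mono2) auto
    also have "\<dots> = 2 powr p * max \<bar>a\<bar> \<bar>b\<bar> powr p" by (simp add: powr_mult)
    also have "max \<bar>a\<bar> \<bar>b\<bar> powr p \<le> \<bar>a\<bar> powr p + \<bar>b\<bar> powr p" by (simp add: max_def)
    finally show ?thesis by (simp add: mult_left_mono)
  qed
  have "diff_energy p f z
      \<le> (\<integral>\<^sup>+y. ennreal (2 powr p) * (ennreal (\<bar>f (z + y)\<bar> powr p) + ennreal (\<bar>f y\<bar> powr p)) \<partial>lborel)"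
    unfolding diff_energy_def
  proof (rule nn_integral_mono)
    fix y
    have "ennreal (2 powr p) * (ennreal (\<bar>f (z + y)\<bar> powr p) + ennreal (\<bar>f y\<bar> powr p))
        = ennreal (2 powr p * (\<bar>f (z + y)\<bar> powr p + \<bar>f y\<bar> powr p))"
      by (simp flip: ennreal_plus ennreal_mult)
    then show "ennreal (max 0 (f (y + z) - f y) powr p)
        \<le> ennreal (2 powr p) * (ennreal (\<bar>f (z + y)\<bar> powr p) + ennreal (\<bar>f y\<bar> powr p))"
      using pw[of "f (z + y)" "f y"] by (simp add: add.commute ennreal_leI)
  qed
  also have "\<dots> = ennreal (2 powr p) * ((\<integral>\<^sup>+y. ennreal (\<bar>f (z + y)\<bar> powr p) \<partial>lborel)
      + (\<integral>\<^sup>+y. ennreal (\<bar>f y\<bar> powr p) \<partial>lborel))"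
    by (simp add: nn_integral_cmult nn_integral_add)
  also have "(\<integral>\<^sup>+y. ennreal (\<bar>f (z + y)\<bar> powr p) \<partial>lborel) = (\<integral>\<^sup>+y. ennreal (\<bar>f y\<bar> powr p) \<partial>lborel)"
    by (rule nn_integral_translate) measurable
  finally show ?thesis by (simp add: mult_2)
qed

lemma grad_energy_scale:
  fixes g :: "'a::euclidean_space \<Rightarrow> 'a"
  assumes [measurable]: "g \<in> borel_measurable borel" and "l > 0"
  shows "grad_energy p g (l *\<^sub>R z) = ennreal (l powr p) * grad_energy p g z"
proof -
  have "max 0 (g y \<bullet> (l *\<^sub>R z)) powr p = l powr p * max 0 (g y \<bullet> z) powr p" for y
  proof -
    have "max 0 (g y \<bullet> (l *\<^sub>R z)) = l * max 0 (g y \<bullet> z)"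
      using assms(2) by (simp add: max_def mult_le_0_iff zero_le_mult_iff)
    then show ?thesis using assms(2) by (simp add: powr_mult)
  qed
  then show ?thesis by (simp add: grad_energy_def ennreal_mult nn_integral_cmult)
qed

lemma scaled_diff_energy_le:
  fixes f :: "'a::euclidean_space \<Rightarrow> real"
  assumes wg: "has_weak_gradient f g"
    and f: "f \<in> borel_measurable borel" and g: "g \<in> borel_measurable borel"
    and p: "p \<ge> 1" and l: "l > 0"
  shows "scaled_energy p K (diff_energy p f) l \<le> (\<integral>\<^sup>+w. grad_energy p g w * indicator K w \<partial>lborel)"
  unfolding scaled_energy_def
proof (intro nn_integral_mono mult_right_mono)
  fix w
  have "ennreal (l powr - p) * diff_energy p f (l *\<^sub>R w) \<le> ennreal (l powr - p) * grad_energy p g (l *\<^sub>R w)"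
    by (intro mult_left_mono diff_energy_le_grad_energy[OF wg f g p]) simp
  also have "\<dots> = ennreal (l powr - p * l powr p) * grad_energy p g w"
    by (simp add: grad_energy_scale[OF g l] ennreal_mult mult.assoc)
  also have "l powr - p * l powr p = 1" using l by (simp flip: powr_add)
  finally show "ennreal (l powr - p) * diff_energy p f (l *\<^sub>R w) \<le> grad_energy p g w" by simp
qed simp

text \<open>Fatou's lemma over \<open>K\<close>, applied to an arbitrary sequence of scales that decreases to 0.\<close>

lemma eventually_less_scaled_diff_energy:
  fixes f :: "'a::euclidean_space \<Rightarrow> real"
  assumes wg: "has_weak_gradient f g"
    and f: "f \<in> borel_measurable borel" and g: "g \<in> borel_measurable borel"
    and p: "p \<ge> 1" and [measurable]: "K \<in> sets borel"
    and c: "c < (\<integral>\<^sup>+w. grad_energy p g w * indicator K w \<partial>lborel)"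
  shows "\<forall>\<^sub>F l in at_right 0. c < scaled_energy p K (diff_energy p f) l"
proof (rule sequentially_imp_eventually_at_right[where b = 1])
  fix t :: "nat \<Rightarrow> real" assume t: "\<And>n. 0 < t n" "t \<longlonglongrightarrow> 0"
  note [measurable] = f g
  have "(\<integral>\<^sup>+w. grad_energy p g w * indicator K w \<partial>lborel)
    \<le> (\<integral>\<^sup>+w. liminf (\<lambda>n. ennreal (t n powr - p) * diff_energy p f (t n *\<^sub>R w) * indicator K w) \<partial>lborel)"
  proof (rule nn_integral_mono)
    fix w
    show "grad_energy p g w * indicator K w
      \<le> liminf (\<lambda>n. ennreal (t n powr - p) * diff_energy p f (t n *\<^sub>R w) * indicator K w)"
      using grad_energy_le_liminf_diff_energy[OF wg f g p t, of w] by (cases "w \<in> K") auto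
  qed
  also have "\<dots> \<le> liminf (\<lambda>n. scaled_energy p K (diff_energy p f) (t n))"
    unfolding scaled_energy_def by (rule nn_integral_liminf) measurable
  finally show "\<forall>\<^sub>F n in sequentially. c < scaled_energy p K (diff_energy p f) (t n)"
    using c by (intro less_LiminfD) (rule less_le_trans)
qed simp

lemma nn_integral_difference_kernel:
  fixes f :: "'a::euclidean_space \<Rightarrow> real" and k :: "'a \<Rightarrow> real"
  assumes f[measurable]: "f \<in> borel_measurable borel" and [measurable]: "k \<in> borel_measurable borel"
    and k: "\<And>z. k z \<ge> 0"
  shows "(\<integral>\<^sup>+y. (\<integral>\<^sup>+x. ennreal (max 0 (f x - f y) powr p / k (x - y)) \<partial>lborel) \<partial>lborel)
    = (\<integral>\<^sup>+z. diff_energy p f z * ennreal (inverse (k z)) \<partial>lborel)"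
proof -
  have "(\<integral>\<^sup>+x. ennreal (max 0 (f x - f y) powr p / k (x - y)) \<partial>lborel)
      = (\<integral>\<^sup>+z. ennreal (max 0 (f (y + z) - f y) powr p) * ennreal (inverse (k z)) \<partial>lborel)" for y
    using nn_integral_translate[of "\<lambda>x. ennreal (max 0 (f x - f y) powr p / k (x - y))" y] k
    by (simp add: divide_inverse ennreal_mult)
  then have "(\<integral>\<^sup>+y. (\<integral>\<^sup>+x. ennreal (max 0 (f x - f y) powr p / k (x - y)) \<partial>lborel) \<partial>lborel)
      = (\<integral>\<^sup>+y. (\<integral>\<^sup>+z. ennreal (max 0 (f (y + z) - f y) powr p) * ennreal (inverse (k z)) \<partial>lborel) \<partial>lborel)"
    by simp
  also have "\<dots> = (\<integral>\<^sup>+z. (\<integral>\<^sup>+y. ennreal (max 0 (f (y + z) - f y) powr p) * ennreal (inverse (k z)) \<partial>lborel) \<partial>lborel)"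
    by (intro lborel_pair.Fubini') measurable
  also have "\<dots> = (\<integral>\<^sup>+z. diff_energy p f z * ennreal (inverse (k z)) \<partial>lborel)"
    by (simp add: nn_integral_multc diff_energy_def)
  finally show ?thesis .
qed

text \<open>The radial limit for \<open>N = scaled_energy p K (diff_energy p f)\<close> and \<open>M\<close> the integral of \<open>grad_energy\<close> over
  \<open>K\<close>; comparison with \<open>grad_energy\<close> supplies its bounds near 0, the \<open>L\<^sup>p\<close> norm of \<open>f\<close> its decay at infinity.\<close>

lemma anisotropic_limit_borel:
  fixes K :: "'a::euclidean_space set" and f :: "'a \<Rightarrow> real"
  assumes p: "p \<ge> 1" and K: "compact K" "convex K" "0 \<in> interior K"
    and wg: "has_weak_gradient f g"
    and f: "f \<in> borel_measurable borel" and g: "g \<in> borel_measurable borel"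
    and fin: "(\<integral>\<^sup>+x. ennreal (\<bar>f x\<bar> powr p) \<partial>lborel) < \<infinity>"
  shows "((\<lambda>s. ennreal (1 - s) *
            (\<integral>\<^sup>+ y. (\<integral>\<^sup>+ x. ennreal (max 0 (f x - f y) powr p
                          / minkowski K (x - y) powr (real DIM('a) + s * p)) \<partial>lborel) \<partial>lborel))
          \<longlongrightarrow> ennreal ((real DIM('a) + p) / p) * (\<integral>\<^sup>+w. grad_energy p g w * indicator K w \<partial>lborel))
         (at_left 1)"
proof -
  note [measurable] = f g borel_measurable_minkowski[OF K]
  have [measurable]: "K \<in> sets borel" using K(1) by (rule borel_compact)
  let ?N = "scaled_energy p K (diff_energy p f)"
  let ?B = "ennreal (2 powr p) * (2 * (\<integral>\<^sup>+x. ennreal (\<bar>f x\<bar> powr p) \<partial>lborel))"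
  have "((\<lambda>s. ennreal (1 - s) * (\<integral>\<^sup>+l. ennreal ((real DIM('a) + s * p) * l powr (p * (1 - s) - 1)) * ?N l
      * indicator {0<..} l \<partial>lborel)) \<longlongrightarrow> ennreal ((real DIM('a) + p) / p)
      * (\<integral>\<^sup>+w. grad_energy p g w * indicator K w \<partial>lborel)) (at_left 1)"
  proof (rule radial_limit)
    show "?N l \<le> ennreal (l powr - p) * (?B * emeasure lborel K)" for l
    proof -
      have "?N l \<le> (\<integral>\<^sup>+w. ennreal (l powr - p) * ?B * indicator K w \<partial>lborel)"
        unfolding scaled_energy_def using p
        by (intro nn_integral_mono mult_right_mono mult_left_mono diff_energy_bound) auto
      also have "\<dots> = ennreal (l powr - p) * ?B * emeasure lborel K"
        by (rule nn_integral_cmult_indicator) simp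
      finally show ?thesis by (simp only: mult.assoc)
    qed
    show "?B * emeasure lborel K < \<infinity>"
      using fin emeasure_compact_finite[OF K(1)] by (simp add: ennreal_mult_less_top)
    show "?N l \<le> (\<integral>\<^sup>+w. grad_energy p g w * indicator K w \<partial>lborel)" if "l > 0" for l
      by (rule scaled_diff_energy_le[OF wg f g p that])
    show "\<forall>\<^sub>F l in at_right 0. c < ?N l"
      if "c < (\<integral>\<^sup>+w. grad_energy p g w * indicator K w \<partial>lborel)" for c
      using eventually_less_scaled_diff_energy[OF wg f g p _ that] by simp
  qed (use p in auto)
  then show ?thesis
  proof (rule Lim_transform_eventually)
    show "\<forall>\<^sub>F s in at_left 1. ennreal (1 - s) * (\<integral>\<^sup>+l. ennreal ((real DIM('a) + s * p) * l powr (p * (1 - s) - 1)) * ?N l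
        * indicator {0<..} l \<partial>lborel) = ennreal (1 - s) *
            (\<integral>\<^sup>+ y. (\<integral>\<^sup>+ x. ennreal (max 0 (f x - f y) powr p
                          / minkowski K (x - y) powr (real DIM('a) + s * p)) \<partial>lborel) \<partial>lborel)"
      using eventually_at_left_real[of 0 "1::real", OF zero_less_one]
    proof eventually_elim
      case (elim s)
      then have a: "real DIM('a) + s * p > 0" using p by (simp add: add_pos_pos)
      have e: "real DIM('a) + p - (real DIM('a) + s * p) - 1 = p * (1 - s) - 1"
        by (simp add: algebra_simps)
      have "(\<integral>\<^sup>+ y. (\<integral>\<^sup>+ x. ennreal (max 0 (f x - f y) powr p
            / minkowski K (x - y) powr (real DIM('a) + s * p)) \<partial>lborel) \<partial>lborel)
          = (\<integral>\<^sup>+z. diff_energy p f z * ennreal (inverse (minkowski K z powr (real DIM('a) + s * p))) \<partial>lborel)"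
        by (intro nn_integral_difference_kernel) measurable
      then show ?case
        using nn_integral_gauge_kernel[OF K a, of "diff_energy p f" p] by (simp only: e) simp
    qed
  qed
qed

text \<open>The power of the gauge of the polar moment body at \<open>v\<close> is a multiple of the integral of \<open>(v \<bullet> w)\<^sub>+ powr p\<close>
  over \<open>w \<in> K\<close>; Tonelli's theorem exchanges this integral with the one over space.\<close>

lemma nn_integral_minkowski_polar_moment_body:
  fixes K :: "'a::euclidean_space set"
  assumes p: "p \<ge> 1" and K: "compact K" and [measurable]: "g \<in> borel_measurable borel"
  shows "(\<integral>\<^sup>+x. ennreal (minkowski (polar_moment_body p K) (g x) powr p) \<partial>lborel)
    = ennreal (real DIM('a) + p) * (\<integral>\<^sup>+w. grad_energy p g w * indicator K w \<partial>lborel)"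
proof -
  have [measurable]: "K \<in> sets borel" using K(1) by (rule borel_compact)
  have *: "ennreal (minkowski (polar_moment_body p K) v powr p)
      = ennreal (real DIM('a) + p) * (\<integral>\<^sup>+w. ennreal (max 0 (v \<bullet> w) powr p) * indicator K w \<partial>lborel)" for v
  proof -
    have cont: "continuous_on K (\<lambda>w. max 0 (v \<bullet> w) powr p)"
      using p by (intro continuous_on_powr' continuous_intros) auto
    have int: "integrable lborel (\<lambda>w. indicator K w *\<^sub>R max 0 (v \<bullet> w) powr p)"
      by (rule borel_integrable_compact[OF K cont])
    have "(LINT w:K|lebesgue. max 0 (v \<bullet> w) powr p) = (LINT w|lborel. indicator K w *\<^sub>R max 0 (v \<bullet> w) powr p)"
      unfolding set_lebesgue_integral_def by (rule integral_completion) measurable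
    moreover have "ennreal (LINT w|lborel. indicator K w *\<^sub>R max 0 (v \<bullet> w) powr p)
        = (\<integral>\<^sup>+w. ennreal (indicator K w *\<^sub>R max 0 (v \<bullet> w) powr p) \<partial>lborel)"
      by (rule nn_integral_eq_integral[OF int, symmetric]) simp
    moreover have "ennreal (indicator K w *\<^sub>R max 0 (v \<bullet> w) powr p)
        = ennreal (max 0 (v \<bullet> w) powr p) * indicator K w" for w
      by (simp add: indicator_def)
    ultimately show ?thesis
      using p by (simp add: minkowski_polar_moment_body_powr ennreal_mult')
  qed
  have "(\<integral>\<^sup>+x. ennreal (minkowski (polar_moment_body p K) (g x) powr p) \<partial>lborel)
    = ennreal (real DIM('a) + p) * (\<integral>\<^sup>+x. (\<integral>\<^sup>+w. ennreal (max 0 (g x \<bullet> w) powr p) * indicator K w \<partial>lborel) \<partial>lborel)"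
    unfolding * by (rule nn_integral_cmult) measurable
  also have "(\<integral>\<^sup>+x. (\<integral>\<^sup>+w. ennreal (max 0 (g x \<bullet> w) powr p) * indicator K w \<partial>lborel) \<partial>lborel)
    = (\<integral>\<^sup>+w. (\<integral>\<^sup>+x. ennreal (max 0 (g x \<bullet> w) powr p) * indicator K w \<partial>lborel) \<partial>lborel)"
    by (rule lborel_pair.Fubini') measurable
  also have "\<dots> = (\<integral>\<^sup>+w. grad_energy p g w * indicator K w \<partial>lborel)"
    by (simp add: grad_energy_def nn_integral_multc)
  finally show ?thesis .
qed

lemma locally_integrable_imp_measurable:
  fixes g :: "'a::euclidean_space \<Rightarrow> 'b::euclidean_space"
  assumes "locally_integrable g"
  shows "g \<in> borel_measurable lebesgue"
proof (rule borel_measurable_LIMSEQ_metric)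
  show "(\<lambda>x. indicator (cball 0 (real n)) x *\<^sub>R g x) \<in> borel_measurable lebesgue" for n
    using assms unfolding locally_integrable_def set_integrable_def
    by (intro borel_measurable_integrable) auto
  fix x :: 'a
  obtain k where k: "norm x \<le> real k" using real_arch_simple by blast
  have "\<forall>\<^sub>F n in sequentially. indicator (cball 0 (real n)) x *\<^sub>R g x = g x"
    using eventually_ge_at_top[of k] by eventually_elim (use k in auto)
  then show "(\<lambda>n. indicator (cball 0 (real n)) x *\<^sub>R g x) \<longlonglongrightarrow> g x"
    by (rule tendsto_eventually)
qed

text \<open>Tonelli's theorem is used for the product Borel structure, so Lebesgue measurable functions have to
  be replaced by Borel measurable ones, here one coordinate at a time.\<close>

lemma lebesgue_ex_borel_vector:
  fixes g :: "'a::euclidean_space \<Rightarrow> 'b::euclidean_space"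
  assumes "g \<in> borel_measurable lebesgue"
  obtains h where "h \<in> borel_measurable borel" "AE x in lebesgue. g x = h x"
proof -
  have "\<exists>h\<in>borel_measurable lborel. AE x in lborel. g x \<bullet> i = h x" for i
    using assms by (intro completion_ex_borel_measurable_real borel_measurable_inner) auto
  then obtain h where h: "\<And>i. h i \<in> borel_measurable lborel" "\<And>i. AE x in lborel. g x \<bullet> i = h i x"
    by metis
  have [measurable]: "h i \<in> borel_measurable borel" for i using h(1)[of i] by simp
  have "AE x in lborel. \<forall>i\<in>Basis. g x \<bullet> i = h i x"
    using h(2) by (intro AE_finite_allI) auto
  then have "AE x in lborel. g x = (\<Sum>i\<in>Basis. h i x *\<^sub>R i)"
  proof eventually_elim
    case (elim x)
    then have "(\<Sum>i\<in>Basis. h i x *\<^sub>R i) = (\<Sum>i\<in>Basis. (g x \<bullet> i) *\<^sub>R i)"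
      by (intro sum.cong) auto
    then show ?case by (simp add: euclidean_representation)
  qed
  then have "AE x in lebesgue. g x = (\<Sum>i\<in>Basis. h i x *\<^sub>R i)"
    by (rule AE_completion)
  then show ?thesis by (intro that[of "\<lambda>x. \<Sum>i\<in>Basis. h i x *\<^sub>R i"]) auto
qed

lemma locally_integrable_cong_AE:
  assumes "locally_integrable g" "h \<in> borel_measurable borel" "AE x in lebesgue. g x = h x"
  shows "locally_integrable h"
  unfolding locally_integrable_def set_integrable_def
proof (intro allI impI)
  fix C :: "'a set" assume C: "compact C"
  then have [measurable]: "C \<in> sets borel" by (rule borel_compact)
  note [measurable] = assms(2)
  have int: "integrable lebesgue (\<lambda>x. indicator C x *\<^sub>R g x)"
    using assms(1) C by (simp add: locally_integrable_def set_integrable_def)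
  have "(\<lambda>x. indicator C x *\<^sub>R h x) \<in> borel_measurable lebesgue"
    by (rule measurable_completion) measurable
  moreover have "AE x in lebesgue. indicator C x *\<^sub>R g x = indicator C x *\<^sub>R h x"
    using assms(3) by eventually_elim simp
  ultimately show "integrable lebesgue (\<lambda>x. indicator C x *\<^sub>R h x)"
    by (rule integrable_cong_AE_imp[OF int])
qed

lemma has_weak_gradient_cong_AE:
  fixes f f' :: "'a::euclidean_space \<Rightarrow> real"
  assumes wg: "has_weak_gradient f g"
    and f': "f' \<in> borel_measurable borel" "AE x in lebesgue. f x = f' x"
    and g': "g' \<in> borel_measurable borel" "AE x in lebesgue. g x = g' x"
  shows "has_weak_gradient f' g'"
  unfolding has_weak_gradient_def
proof (intro conjI allI impI ballI)
  show "locally_integrable f'" "locally_integrable g'"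
    using wg f' g' by (auto simp: has_weak_gradient_def intro: locally_integrable_cong_AE)
  fix \<phi> :: "'a \<Rightarrow> real" and i :: 'a
  assume \<phi>: "test_function \<phi>" and i: "i \<in> Basis"
  have Ck: "Ck 0 \<phi>" "Ck (Suc 0) \<phi>" using \<phi> by (auto simp only: test_function_def)
  then have [measurable]: "\<phi> \<in> borel_measurable lebesgue"
    "(\<lambda>x. frechet_derivative \<phi> (at x) i) \<in> borel_measurable lebesgue"
    using i by (auto intro!: measurable_completion borel_measurable_continuous_onI)
  have [measurable]: "f \<in> borel_measurable lebesgue" "g \<in> borel_measurable lebesgue"
    "f' \<in> borel_measurable lebesgue" "g' \<in> borel_measurable lebesgue"
    using wg f'(1) g'(1)
    by (auto simp: has_weak_gradient_def intro: locally_integrable_imp_measurable measurable_completion)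
  have "(LINT x|lebesgue. f' x * frechet_derivative \<phi> (at x) i) = (LINT x|lebesgue. f x * frechet_derivative \<phi> (at x) i)"
    using f'(2) by (intro integral_cong_AE) auto
  moreover have "(LINT x|lebesgue. (g' x \<bullet> i) * \<phi> x) = (LINT x|lebesgue. (g x \<bullet> i) * \<phi> x)"
    using g'(2) by (intro integral_cong_AE) auto
  ultimately show "(LINT x|lebesgue. f' x * frechet_derivative \<phi> (at x) i) = - (LINT x|lebesgue. (g' x \<bullet> i) * \<phi> x)"
    using wg \<phi> i by (simp add: has_weak_gradient_def)
qed

theorem theorem1:
  fixes K :: "'a::euclidean_space set" and p :: real
    and f :: "'a \<Rightarrow> real" and grad_f :: "'a \<Rightarrow> 'a"
  assumes "1 \<le> p"
    and "convex_body K" and "0 \<in> interior K"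
    and "f \<in> sobolev_W1 p" and "compactly_supported f"
    and "has_weak_gradient f grad_f"
  shows "((\<lambda>s. ennreal (1 - s) *
            (\<integral>\<^sup>+ y. (\<integral>\<^sup>+ x. ennreal (max 0 (f x - f y) powr p
                          / minkowski K (x - y) powr (real DIM('a) + s * p)) \<partial>lebesgue) \<partial>lebesgue))
          \<longlongrightarrow> ennreal (1 / p) *
            (\<integral>\<^sup>+ x. ennreal (minkowski (polar_moment_body p K) (grad_f x) powr p) \<partial>lebesgue))
         (at_left 1)"
proof -
  have K: "compact K" "convex K" "0 \<in> interior K"
    using assms(2,3) by (auto simp: convex_body_def)
  have fm: "f \<in> borel_measurable lebesgue" "integrable lebesgue (\<lambda>x. \<bar>f x\<bar> powr p)"
    using assms(4) by (auto simp: sobolev_W1_def Lp_def)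
  obtain f' where f': "f' \<in> borel_measurable borel" "AE x in lebesgue. f x = f' x"
    using lebesgue_ex_borel_vector[OF fm(1)] by blast
  obtain g where g: "g \<in> borel_measurable borel" "AE x in lebesgue. grad_f x = g x"
    using lebesgue_ex_borel_vector[OF locally_integrable_imp_measurable] assms(6)
    unfolding has_weak_gradient_def by blast
  have wg: "has_weak_gradient f' g"
    by (rule has_weak_gradient_cong_AE[OF assms(6) f' g])
  have "(\<integral>\<^sup>+x. ennreal (\<bar>f' x\<bar> powr p) \<partial>lebesgue) = (\<integral>\<^sup>+x. ennreal (\<bar>f x\<bar> powr p) \<partial>lebesgue)"
    using f'(2) by (intro nn_integral_cong_AE) auto
  also have "\<dots> < \<infinity>" using fm(2) by (simp add: integrable_iff_bounded)
  finally have fin: "(\<integral>\<^sup>+x. ennreal (\<bar>f' x\<bar> powr p) \<partial>lborel) < \<infinity>"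
    by (simp only: nn_integral_completion)
  have lhs: "(\<integral>\<^sup>+ y. (\<integral>\<^sup>+ x. ennreal (max 0 (f x - f y) powr p
        / minkowski K (x - y) powr (real DIM('a) + s * p)) \<partial>lebesgue) \<partial>lebesgue)
    = (\<integral>\<^sup>+ y. (\<integral>\<^sup>+ x. ennreal (max 0 (f' x - f' y) powr p
        / minkowski K (x - y) powr (real DIM('a) + s * p)) \<partial>lborel) \<partial>lborel)" for s
  proof -
    have "AE y in lebesgue. (\<integral>\<^sup>+ x. ennreal (max 0 (f x - f y) powr p
        / minkowski K (x - y) powr (real DIM('a) + s * p)) \<partial>lebesgue)
      = (\<integral>\<^sup>+ x. ennreal (max 0 (f' x - f' y) powr p
        / minkowski K (x - y) powr (real DIM('a) + s * p)) \<partial>lebesgue)"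
      using f'(2)
    proof eventually_elim
      case (elim y)
      show ?case using f'(2) by (intro nn_integral_cong_AE) (auto simp: elim)
    qed
    from nn_integral_cong_AE[OF this] show ?thesis by (simp only: nn_integral_completion)
  qed
  have rhs: "(\<integral>\<^sup>+ x. ennreal (minkowski (polar_moment_body p K) (grad_f x) powr p) \<partial>lebesgue)
    = ennreal (real DIM('a) + p) * (\<integral>\<^sup>+w. grad_energy p g w * indicator K w \<partial>lborel)"
  proof -
    have "(\<integral>\<^sup>+ x. ennreal (minkowski (polar_moment_body p K) (grad_f x) powr p) \<partial>lebesgue)
      = (\<integral>\<^sup>+ x. ennreal (minkowski (polar_moment_body p K) (g x) powr p) \<partial>lebesgue)"
      using g(2) by (intro nn_integral_cong_AE) auto
    then show ?thesis
      by (simp only: nn_integral_completion nn_integral_minkowski_polar_moment_body[OF assms(1) K(1) g(1)])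
  qed
  have "ennreal (1 / p) * (ennreal (real DIM('a) + p) * M) = ennreal ((real DIM('a) + p) / p) * M" for M
  proof -
    have "ennreal (1 / p) * ennreal (real DIM('a) + p) = ennreal ((real DIM('a) + p) / p)"
      using assms(1) by (subst ennreal_mult[symmetric]) auto
    then show ?thesis by (simp only: mult.assoc[symmetric])
  qed
  then show ?thesis
    unfolding lhs rhs using anisotropic_limit_borel[OF assms(1) K wg f'(1) g(1) fin] by simp
qed

end
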